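(* Let $\mathfrak{M}=(M,\oplus,\preceq,0)$ be an archimedean distance monoid. Then the class $\overrightarrow{\mathcal{M}}_{\mathfrak{M}}$ of all finite $\mathfrak{M}$-metric spaces equipped with a free (i.e. arbitrary) linear ordering of vertices is a Ramsey class.
   Context: A distance monoid is a structure $\mathfrak{M}=(M,\oplus,\preceq,0)$ such that (1) $(M,\oplus,0)$ is a commutative monoid with identity $0$; (2) $\preceq$ is a linear order on $M$ with least element $0$; (3) for all $a,b,c,d\in M$, if $a\preceq c$ and $b\preceq d$ then $a\oplus b\preceq c\oplus d$. Write $n\times r$ for the sum $r\oplus\cdots\oplus r$ of length $n$. A distance monoid is archimedean if for all $r,s\in M$ with $r,s\neq 0$ there is an integer $n>0$ with $s\preceq n\times r$. An $\mathfrak{M}$-metric space is a set $A$ with a function $d:A\times A\to M$ such that for all $a,b,c\in A$: $d(a,b)=0$ iff $a=b$; $d(a,b)=d(b,a)$; and $d(a,c)\preceq d(a,b)\oplus d(b,c)$. The structures in $\overrightarrow{\mathcal{M}}_{\mathfrak{M}}$ here are triples $(A,d,\leq)$ with $(A,d)$ a finite $\mathfrak{M}$-metric space and $\leq$ any linear order on $A$. Substructures are subsets with restricted $d$ and $\leq$; isomorphisms are bijections preserving both $d$ and $\leq$. For structures $\mathbf{A},\mathbf{B}$, let $\binom{\mathbf{B}}{\mathbf{A}}$ be the set of all substructures of $\mathbf{B}$ isomorphic to $\mathbf{A}$. A class $\mathcal{C}$ of structures is a Ramsey class if for all $\mathbf{A},\mathbf{B}\in\mathcal{C}$ and every positive integer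 $k$ there is $\mathbf{C}\in\mathcal{C}$ such that for every partition of $\binom{\mathbf{C}}{\mathbf{A}}$ into $k$ classes there is $\widetilde{\mathbf{B}}\in\binom{\mathbf{C}}{\mathbf{B}}$ such that $\binom{\widetilde{\mathbf{B}}}{\mathbf{A}}$ is contained in one class of the partition. *)

theory Defs
  imports "HOL-Library.FuncSet" "HOL-Library.Disjoint_Sets"
begin

class distance_monoid = comm_monoid_add + linorder +
  assumes zero_least: "0 \<le> a"
    and add_mono_both: "a \<le> c \<Longrightarrow> b \<le> d \<Longrightarrow> a + b \<le> c + d"

definition nmult :: "nat \<Rightarrow> 'm::monoid_add \<Rightarrow> 'm"
  where "nmult n r = sum_list (replicate n r)"

definition monoid_metric :: "'v set \<Rightarrow> ('v \<times> 'v \<Rightarrow> 'm::distance_monoid) \<Rightarrow> bool"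
  where "monoid_metric V d \<longleftrightarrow>
    (\<forall>a\<in>V. \<forall>b\<in>V. d (a, b) = 0 \<longleftrightarrow> a = b) \<and>
    (\<forall>a\<in>V. \<forall>b\<in>V. d (a, b) = d (b, a)) \<and>
    (\<forall>a\<in>V. \<forall>b\<in>V. \<forall>c\<in>V. d (a, c) \<le> d (a, b) + d (b, c))"

text \<open>
  The order is the reflexive relation, given as a set of pairs.
  The vertices are drawn from a fixed type \<open>'v\<close>. As soon as \<open>'v\<close> is infinite, every
  finite structure, whatever its vertices, is isomorphic to one over \<open>'v\<close>.
\<close>

record ('v, 'm) ordered_space =
  verts :: "'v set"
  distance :: "'v \<times> 'v \<Rightarrow> 'm"
  order_rel :: "'v rel"

text \<open>
  The distance is a function on \<open>V \<times> V\<close> only: requiring it to be \<open>extensional\<close>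
  (equal to \<open>undefined\<close> elsewhere) makes equality of records coincide with equality of
  the triples. In particular each subset of \<open>V\<close> carries exactly one substructure.
  The same remark explains the use of \<open>restrict\<close> in \<open>induced\<close>.
\<close>

definition ordered_metric_spaces :: "('v, 'm::distance_monoid) ordered_space set"
  where "ordered_metric_spaces = {A.
    finite (verts A) \<and>
    distance A \<in> extensional (verts A \<times> verts A) \<and>
    monoid_metric (verts A) (distance A) \<and>
    linear_order_on (verts A) (order_rel A)}"

definition induced :: "('v, 'm) ordered_space \<Rightarrow> 'v set \<Rightarrow> ('v, 'm) ordered_space"
  where "induced B S = \<lparr>verts = S,
    distance = restrict (distance B) (S \<times> S),
    order_rel = order_rel B \<inter> S \<times> S\<rparr>"

definition substructures :: "('v, 'm) ordered_space \<Rightarrow> ('v, 'm) ordered_space set"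
  where "substructures B = {induced B S | S. S \<subseteq> verts B}"

definition isomorphism ::
    "('v \<Rightarrow> 'w) \<Rightarrow> ('v, 'm) ordered_space \<Rightarrow> ('w, 'm) ordered_space \<Rightarrow> bool"
  where "isomorphism f A B \<longleftrightarrow> bij_betw f (verts A) (verts B) \<and>
    (\<forall>x\<in>verts A. \<forall>y\<in>verts A.
      distance B (f x, f y) = distance A (x, y) \<and>
      ((f x, f y) \<in> order_rel B \<longleftrightarrow> (x, y) \<in> order_rel A))"

definition isomorphic :: "('v, 'm) ordered_space \<Rightarrow> ('w, 'm) ordered_space \<Rightarrow> bool"
  where "isomorphic A B \<longleftrightarrow> (\<exists>f. isomorphism f A B)"

definition copies :: "('v, 'm) ordered_space \<Rightarrow> ('v, 'm) ordered_space \<Rightarrow> ('v, 'm) ordered_space set"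
  where "copies B A = {A' \<in> substructures B. isomorphic A A'}"

text \<open>
  The classes \<open>P 0, \<dots>, P (k - 1)\<close> of a partition are allowed to be empty, as usual in
  Ramsey theory. (With nonempty classes the property would hold vacuously
  whenever \<open>copies C A\<close> has fewer than \<open>k\<close> elements.)
\<close>

definition ramsey_class :: "('v, 'm) ordered_space set \<Rightarrow> bool"
  where "ramsey_class \<C> \<longleftrightarrow>
    (\<forall>A\<in>\<C>. \<forall>B\<in>\<C>. \<forall>k>0. \<exists>C\<in>\<C>. \<forall>P :: nat \<Rightarrow> ('v, 'm) ordered_space set.
      disjoint_family_on P {..<k} \<and> (\<Union>i<k. P i) = copies C A \<longrightarrow>
      (\<exists>B'\<in>copies C B. \<exists>i<k. copies B' A \<subseteq> P i))"

end

theory Submission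
  imports Defs "HOL-Library.List_Lexorder"
begin

text \<open>
  The proof transfers the Graham--Rothschild theorem to metric spaces, following the idea of a
  pre-adjunction (Masulovic).

  Only finitely many distances occur in \<open>A\<close> and \<open>B\<close>. Let \<open>top\<close> be the largest of them. As the
  monoid is archimedean, all but finitely many sums of these distances are at least \<open>top\<close>, so the
  sums truncated at \<open>top\<close> form a finite set \<open>V\<close> that is closed under truncated addition
  (\<open>ex_truncated_monoid\<close>). Moreover adding a nonzero \<open>r\<close> always gains something: every nonzero
  \<open>v\<close> in \<open>V\<close> satisfies \<open>v \<le> c + r\<close> for some \<open>c < v\<close> in \<open>V\<close>. This is where the
  archimedean property enters a second time; if addition is the maximum, there is no such gain for
  \<open>r < v\<close>.

  To a space \<open>A\<close> belongs the finite set of all functions \<open>f : A \<rightarrow> V\<close> with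
  \<open>f x \<le> f y + d (x, y)\<close>, ordered by \<open>prec\<close>: two functions are compared at the largest value that
  one of them takes where they differ and, among the points of difference with this value, at the
  first one. If \<open>A\<close> is embedded in \<open>B\<close>, restriction maps the functions of \<open>B\<close> onto those of
  \<open>A\<close>, since every function has a pointwise least extension. By the gain just described, the
  values of a least extension outside \<open>A\<close> have no influence on comparisons, so that taking least
  extensions is monotone (\<open>extension_prec\<close>). Hence restriction is a rigid surjection: the first
  preimages of the functions of \<open>A\<close> come in increasing order (\<open>restriction_rigid\<close>).

  The witness \<open>C\<close> is the set of words of length \<open>n\<close> over \<open>V\<close> with the maximum metric and the
  lexicographic order. A rigid surjection \<open>u\<close> from \<open>{0..<n}\<close> to the functions of \<open>A\<close> embeds
  \<open>A\<close> into \<open>C\<close>: the point \<open>x\<close> is sent to the word whose \<open>p\<close>-th letter is the value at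
  \<open>x\<close> of the \<open>p\<close>-th function. Distances are preserved because the functions \<open>d (x, _)\<close>
  occur, and the order is preserved because the least function separating two points is smaller at the
  smaller point (\<open>point_less\<close>). Embeddings of \<open>A\<close> into \<open>B\<close> correspond to composing a
  rigid surjection to the functions of \<open>B\<close> with a restriction map. So a colouring of the copies of
  \<open>A\<close> in \<open>C\<close> induces one of rigid surjections, and the dual Ramsey theorem \<open>dual_ramsey\<close>
  yields the required copy of \<open>B\<close>.

  As for the dual Ramsey theorem, the Hales--Jewett theorem gives a finite form of the
  Carlson--Simpson theorem, which in turn drives the induction on the number of parameters that
  proves the Graham--Rothschild theorem.
\<close>

section \<open>Restricted growth words and substitution\<close>

text \<open>
  Restricted growth words: the letters below \<open>t\<close> are available from the start, and the letters
  \<open>t, t + 1, \<dots>, s - 1\<close> (the parameters) all occur, their first occurrences being in increasing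
  order. In particular \<open>rigid 0 s w\<close> says that \<open>w\<close>, as a map from positions to letters, is a
  rigid surjection onto \<open>{..<s}\<close>, and \<open>rigid t (t + m) w\<close> says that \<open>w\<close> is an
  \<open>m\<close>-parameter word over an alphabet of \<open>t\<close> letters.
\<close>

fun rigid :: "nat \<Rightarrow> nat \<Rightarrow> nat list \<Rightarrow> bool" where
  "rigid t s [] \<longleftrightarrow> t = s"
| "rigid t s (c # w) \<longleftrightarrow> c < t \<and> rigid t s w \<or> c = t \<and> rigid (Suc t) s w"

lemma rigid_le: "rigid t s w \<Longrightarrow> t \<le> s"
  by (induction t s w rule: rigid.induct) auto

lemma rigid_append: "rigid t s u \<Longrightarrow> rigid s q v \<Longrightarrow> rigid t q (u @ v)"
  by (induction t s u rule: rigid.induct) auto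

lemma rigid_letters_append: "set x \<subseteq> {..<t} \<Longrightarrow> rigid t s (x @ v) \<longleftrightarrow> rigid t s v"
  by (induction x) auto

lemma rigid_self_iff: "rigid t t w \<longleftrightarrow> set w \<subseteq> {..<t}"
  by (induction w) (auto dest: rigid_le)

lemma rigid_upt: "t \<le> s \<Longrightarrow> rigid t s [t..<s]"
proof (induction "s - t" arbitrary: t)
  case (Suc k)
  then have "[t..<s] = t # [Suc t..<s]"
    by (simp add: upt_conv_Cons)
  with Suc show ?case by simp
qed simp

lemma rigid_set: "rigid t s w \<Longrightarrow> set w \<subseteq> {..<s} \<and> {t..<s} \<subseteq> set w"
proof (induction w arbitrary: t)
  case (Cons c w)
  then consider "c < t" "rigid t s w" | "c = t" "rigid (Suc t) s w" by auto
  then show ?case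
  proof cases
    case 1
    with Cons.IH[of t] rigid_le[OF 1(2)] show ?thesis by auto
  next
    case 2
    with Cons.IH[of "Suc t"] rigid_le[OF 2(2)] show ?thesis
      by (auto simp: subset_iff) (metis atLeastLessThan_iff le_antisym not_less_eq_eq)
  qed
qed simp

lemma rigid_first_occurrence:
  "rigid t s w \<Longrightarrow> p < length w \<Longrightarrow> t \<le> i \<Longrightarrow> i < w ! p \<Longrightarrow> \<exists>q<p. w ! q = i"
proof (induction w arbitrary: t p)
  case (Cons c w)
  show ?case
  proof (cases p)
    case 0
    with Cons.prems show ?thesis by auto
  next
    case (Suc p')
    consider "c < t" "rigid t s w" | "c = t" "rigid (Suc t) s w"
      using Cons.prems by auto
    then show ?thesis
    proof cases
      case 1
      from Cons.IH[OF 1(2), of p'] Cons.prems Suc obtain q where "q < p'" "w ! q = i"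
        by auto
      then show ?thesis using Suc by (intro exI[of _ "Suc q"]) auto
    next
      case 2
      show ?thesis
      proof (cases "i = t")
        case True
        then show ?thesis using 2 Suc by (intro exI[of _ 0]) auto
      next
        case False
        with Cons.IH[OF 2(2), of p'] Cons.prems Suc obtain q where "q < p'" "w ! q = i"
          by auto
        then show ?thesis using Suc by (intro exI[of _ "Suc q"]) auto
      qed
    qed
  qed
qed simp

lemma rigidI:
  assumes "t \<le> s" "set w \<subseteq> {..<s}" "{t..<s} \<subseteq> set w"
    and "\<And>p i. p < length w \<Longrightarrow> t \<le> i \<Longrightarrow> i < w ! p \<Longrightarrow> \<exists>q<p. w ! q = i"
  shows "rigid t s w"
  using assms
proof (induction w arbitrary: t)
  case (Cons c w)
  have "c \<le> t"
    using Cons.prems(4)[of 0 t] by (cases "c \<le> t") auto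
  then consider "c < t" | "c = t" by linarith
  then show ?case
  proof cases
    case 1
    have "rigid t s w"
    proof (rule Cons.IH)
      fix p i assume "p < length w" "t \<le> i" "i < w ! p"
      then obtain q where "q < Suc p" "(c # w) ! q = i"
        using Cons.prems(4)[of "Suc p" i] by auto
      then show "\<exists>q<p. w ! q = i"
        using 1 \<open>t \<le> i\<close> by (cases q) auto
    qed (use Cons.prems 1 in auto)
    then show ?thesis using 1 by simp
  next
    case 2
    have "rigid (Suc t) s w"
    proof (rule Cons.IH)
      fix p i assume "p < length w" "Suc t \<le> i" "i < w ! p"
      then obtain q where "q < Suc p" "(c # w) ! q = i"
        using Cons.prems(4)[of "Suc p" i] by auto
      then show "\<exists>q<p. w ! q = i"
        using 2 \<open>Suc t \<le> i\<close> by (cases q) auto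
    next
      show "{Suc t..<s} \<subseteq> set w"
      proof
        fix x assume "x \<in> {Suc t..<s}"
        moreover from this have "x \<in> set (c # w)" using Cons.prems(3) Suc_leD by fastforce
        ultimately show "x \<in> set w" using 2 by auto
      qed
    qed (use Cons.prems 2 in auto)
    then show ?thesis using 2 by simp
  qed
qed simp

lemma rigid_rename:
  assumes "rigid t (t + l) v" "\<And>c. c < t \<Longrightarrow> f c < t'" "\<And>j. j < l \<Longrightarrow> f (t + j) = t' + j"
  shows "rigid t' (t' + l) (map f v)"
  using assms
proof (induction v arbitrary: t t' l)
  case (Cons c v)
  then consider "c < t" "rigid t (t + l) v" | "c = t" "rigid (Suc t) (t + l) v" by auto
  then show ?case
  proof cases
    case 1
    with Cons.IH[of t l t'] Cons.prems show ?thesis by auto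
  next
    case 2
    from rigid_le[OF 2(2)] obtain l' where l: "l = Suc l'" by (cases l) auto
    have "rigid (Suc t') (Suc t' + l') (map f v)"
    proof (rule Cons.IH)
      show "f c < Suc t'" if "c < Suc t" for c
        using Cons.prems(2)[of c] Cons.prems(3)[of 0] that l by (cases "c = t") auto
      show "f (Suc t + j) = Suc t' + j" if "j < l'" for j
        using Cons.prems(3)[of "Suc j"] that l by auto
    qed (use 2 l in auto)
    then show ?thesis using 2 l Cons.prems(3)[of 0] by auto
  qed
qed simp

lemma rigid_first_parameter:
  "rigid t s w \<Longrightarrow> t < s \<Longrightarrow> \<exists>x v. w = x @ t # v \<and> set x \<subseteq> {..<t} \<and> rigid (Suc t) s v"
proof (induction w)
  case (Cons c w)
  then consider "c < t" "rigid t s w" | "c = t" "rigid (Suc t) s w" by auto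
  then show ?case
  proof cases
    case 1
    with Cons obtain x v where "w = x @ t # v \<and> set x \<subseteq> {..<t} \<and> rigid (Suc t) s v" by auto
    then show ?thesis using 1 by (intro exI[of _ "c # x"] exI[of _ v]) auto
  next
    case 2
    then show ?thesis by (intro exI[of _ "[]"] exI[of _ w]) auto
  qed
qed simp

text \<open>
  Substitution of the word \<open>w\<close> for the parameters of \<open>u\<close>: the letters below \<open>t\<close> stay, and
  the parameter \<open>t + i\<close> is replaced by \<open>w ! i\<close>. If \<open>w\<close> is too short to provide a value
  for every parameter, the result is cut off before the first parameter that receives no value. The cut
  makes substitution associative also for partial assignments (\<open>subst_subst\<close>).
\<close>

definition letter_value :: "nat \<Rightarrow> nat list \<Rightarrow> nat \<Rightarrow> nat"
  where "letter_value t w c = (if c < t then c else w ! (c - t))"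

definition subst :: "nat \<Rightarrow> nat list \<Rightarrow> nat list \<Rightarrow> nat list"
  where "subst t w u = map (letter_value t w) (takeWhile (\<lambda>c. c < t + length w) u)"

lemma length_subst_le: "length (subst t w u) \<le> length u"
  by (simp add: subst_def length_takeWhile_le)

lemma subst_full: "set u \<subseteq> {..<t + length w} \<Longrightarrow> subst t w u = map (letter_value t w) u"
  unfolding subst_def by (subst takeWhile_eq_all_conv[THEN iffD2]) auto

lemma subst_truncate: "rigid t s u \<Longrightarrow> t + length x < s \<Longrightarrow> subst t x (u @ z) = subst t x u"
  unfolding subst_def using rigid_set[of t s u]
  by (subst takeWhile_append1[of "t + length x"]) auto

text \<open>
  The induction runs through \<open>u\<close> while \<open>k\<close> bounds the letters met so far. Both sides stop at the
  first letter for which no value is provided, which by restricted growth is \<open>t + length y\<close>.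
\<close>

lemma subst_subst_aux:
  fixes t x q
  defines "y \<equiv> subst t x q"
  assumes "rigid k s u" "k \<le> t + length y"
  shows "subst t y u = subst t x (subst t q u)"
  using assms(2,3)
proof (induction u arbitrary: k)
  case (Cons c u)
  have less: "length y \<le> length q"
    by (simp add: y_def length_subst_le)
  have in1: "letter_value t q c' < t + length x" "letter_value t y c' = letter_value t x (letter_value t q c')" if "c' < t + length y" for c'
  proof -
    have *: "takeWhile (\<lambda>c. c < t + length x) q ! i = q ! i \<and> q ! i < t + length x" if "i < length y" for i
    proof -
      have i: "i < length (takeWhile (\<lambda>c. c < t + length x) q)"
        using that by (simp add: y_def subst_def)
      from nth_mem[OF this] takeWhile_nth[OF i] show ?thesis
        by (auto dest: set_takeWhileD)
    qed
    show "letter_value t q c' < t + length x"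
      using that *[of "c' - t"] by (auto simp: letter_value_def)
    have "y ! i = letter_value t x (q ! i)" if "i < length y" for i
      using that *[OF that] unfolding y_def subst_def by auto
    then show "letter_value t y c' = letter_value t x (letter_value t q c')"
      using that by (auto simp: letter_value_def)
  qed
  have out: "\<not> letter_value t q (t + length y) < t + length x" if "length y < length q"
    using nth_length_takeWhile[of "\<lambda>c. c < t + length x" q] that
    unfolding y_def subst_def by (simp add: letter_value_def)
  consider "c < k" "rigid k s u" | "c = k" "rigid (Suc k) s u" using Cons.prems by auto
  then show ?case
  proof cases
    case 1
    then show ?thesis using Cons.IH[of k] Cons.prems less in1[of c] by (auto simp: subst_def)
  next
    case 2
    show ?thesis
    proof (cases "k < t + length y")
      case True
      then show ?thesis using Cons.IH[of "Suc k"] 2 less in1[of c] by (auto simp: subst_def)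
    next
      case False
      then have k: "k = t + length y" using Cons.prems by simp
      show ?thesis using out less 2 k by (cases "length y < length q") (auto simp: subst_def)
    qed
  qed
qed (simp add: subst_def)

lemma subst_subst: "rigid t s u \<Longrightarrow> subst t (subst t x q) u = subst t x (subst t q u)"
  by (rule subst_subst_aux) auto

text \<open>
  Here \<open>k\<close> bounds the letters of \<open>u\<close> met so far and \<open>j\<close> those of the result, so that exactly the
  first \<open>k - t\<close> letters of \<open>w\<close> have been used.
\<close>

lemma rigid_subst_aux:
  "rigid k s u \<Longrightarrow> t \<le> k \<Longrightarrow> k \<le> t + length w \<Longrightarrow> t + length w \<le> s \<Longrightarrow>
   rigid j s' (drop (k - t) w) \<Longrightarrow> t \<le> j \<Longrightarrow> set (take (k - t) w) \<subseteq> {..<j} \<Longrightarrow> rigid j s' (subst t w u)"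
proof (induction u arbitrary: k j)
  case Nil
  then show ?case by (auto simp: subst_def)
next
  case (Cons c u)
  consider "c < k" "rigid k s u" | "c = k" "rigid (Suc k) s u" using Cons.prems by auto
  then show ?case
  proof cases
    case 1
    have "letter_value t w c < j"
    proof (cases "c < t")
      case False
      then have "w ! (c - t) \<in> set (take (k - t) w)"
        using 1 Cons.prems by (auto simp: in_set_conv_nth intro!: exI[of _ "c - t"])
      then show ?thesis using False Cons.prems by (auto simp: letter_value_def)
    qed (use Cons.prems in \<open>auto simp: letter_value_def\<close>)
    moreover have "rigid j s' (subst t w u)"
      using Cons.IH[OF 1(2)] Cons.prems by blast
    ultimately show ?thesis using 1 Cons.prems by (auto simp: subst_def)
  next
    case 2
    show ?thesis
    proof (cases "k = t + length w")
      case True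
      then show ?thesis using 2 Cons.prems by (auto simp: subst_def)
    next
      case False
      then have k: "k - t < length w" using Cons.prems by auto
      have d: "drop (k - t) w = w ! (k - t) # drop (Suc k - t) w"
        using Cons_nth_drop_Suc[OF k] Cons.prems by (simp add: Suc_diff_le)
      have tk: "take (Suc k - t) w = take (k - t) w @ [w ! (k - t)]"
        using take_Suc_conv_app_nth[OF k] Cons.prems by (simp add: Suc_diff_le)
      have l: "letter_value t w c = w ! (k - t)" using 2 Cons.prems by (auto simp: letter_value_def)
      from Cons.prems(5) d consider
        "w ! (k - t) < j" "rigid j s' (drop (Suc k - t) w)"
        | "w ! (k - t) = j" "rigid (Suc j) s' (drop (Suc k - t) w)" by auto
      then show ?thesis
      proof cases
        case a: 1
        have "rigid j s' (subst t w u)"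
          by (rule Cons.IH[OF 2(2)]) (use Cons.prems k a tk in auto)
        then show ?thesis using 2 a l k by (auto simp: subst_def)
      next
        case a: 2
        have "rigid (Suc j) s' (subst t w u)"
          by (rule Cons.IH[OF 2(2)]) (use Cons.prems k a tk in auto)
        then show ?thesis using 2 a l k by (auto simp: subst_def)
      qed
    qed
  qed
qed

lemma rigid_subst:
  "rigid t s u \<Longrightarrow> t + length w \<le> s \<Longrightarrow> rigid t s' w \<Longrightarrow> rigid t s' (subst t w u)"
  by (rule rigid_subst_aux[of t s]) auto

lemma subst_split_aux:
  "rigid k s u \<Longrightarrow> k \<le> t + length x \<Longrightarrow> t + length x < s \<Longrightarrow>
   \<exists>y. subst t (x @ d # z) u = subst t x u @ d # y"
proof (induction u arbitrary: k)
  case (Cons c u)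
  have letter_value: "letter_value t (x @ d # z) c = letter_value t x c" if "c < t + length x"
    using that by (auto simp: letter_value_def nth_append)
  consider "c < k" "rigid k s u" | "c = k" "rigid (Suc k) s u" using Cons.prems by auto
  then show ?case
  proof cases
    case 1
    with Cons.IH[of k] Cons.prems letter_value show ?thesis by (auto simp: subst_def)
  next
    case 2
    with Cons.IH[of "Suc k"] Cons.prems letter_value show ?thesis
      by (cases "k < t + length x") (auto simp: subst_def letter_value_def nth_append)
  qed
qed simp

lemma subst_split:
  "rigid t s u \<Longrightarrow> t + length x < s \<Longrightarrow> \<exists>y. subst t (x @ d # z) u = subst t x u @ d # y"
  by (rule subst_split_aux) auto

section \<open>The Hales--Jewett theorem\<close>

text \<open>
  Colours are natural numbers in the inductive arguments below; this encodes any other finite set of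
  colours.
\<close>

lemma colour_code:
  assumes "finite (C :: 'c set)"
  obtains f :: "'c \<Rightarrow> nat" where "inj_on f C" "\<And>c. c \<in> C \<Longrightarrow> f c < card C"
proof -
  from ex_bij_betw_finite_nat[OF assms] obtain f where "bij_betw f C {0..<card C}" by blast
  then show thesis by (intro that[of f]) (auto simp: bij_betw_def)
qed

text \<open>
  The word obtained from the one-parameter word \<open>v\<close> by the letter \<open>a\<close> for its parameter \<open>t\<close>.
\<close>

definition line :: "nat \<Rightarrow> nat \<Rightarrow> nat list \<Rightarrow> nat list"
  where "line t a v = map (\<lambda>c. if c = t then a else c) v"

lemma line_append: "line t a (u @ v) = line t a u @ line t a v"
  by (simp add: line_def)

lemma length_line [simp]: "length (line t a v) = length v"
  by (simp add: line_def)

lemma set_line: "rigid t (Suc t) v \<Longrightarrow> a < T \<Longrightarrow> t \<le> T \<Longrightarrow> set (line t a v) \<subseteq> {..<T}"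
  using rigid_set[of t "Suc t" v] by (auto simp: line_def subset_iff less_Suc_eq)

text \<open>
  The word \<open>v\<close> of length \<open>n\<close> with the single parameter \<open>t\<close> is a combinatorial line: all of
  its \<open>t\<close> points have the same colour.
\<close>

definition monochromatic_line :: "(nat list \<Rightarrow> nat) \<Rightarrow> nat \<Rightarrow> nat \<Rightarrow> bool"
  where "monochromatic_line \<chi> t n \<longleftrightarrow>
    (\<exists>v. length v = n \<and> rigid t (Suc t) v \<and> (\<forall>a<t. \<forall>b<t. \<chi> (line t a v) = \<chi> (line t b v)))"

text \<open>
  There are \<open>k\<close> lines over \<open>t + 1\<close> letters, all of which meet in the word \<open>f\<close> at the letter
  \<open>t\<close>; each of them is monochromatic apart from this point, and these colours are distinct.
\<close>

definition focused_lines :: "(nat list \<Rightarrow> nat) \<Rightarrow> nat \<Rightarrow> nat \<Rightarrow> nat \<Rightarrow> bool"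
  where "focused_lines \<chi> t n k \<longleftrightarrow>
    (\<exists>(U :: nat \<Rightarrow> nat list) f. length f = n \<and> set f \<subseteq> {..<Suc t} \<and>
      inj_on (\<lambda>i. \<chi> (line (Suc t) 0 (U i))) {..<k} \<and>
      (\<forall>i<k. rigid (Suc t) (Suc (Suc t)) (U i) \<and> line (Suc t) t (U i) = f \<and>
        (\<forall>a<t. \<chi> (line (Suc t) a (U i)) = \<chi> (line (Suc t) 0 (U i)))))"

text \<open>
  Words of length \<open>n\<close> suffice for the Hales--Jewett theorem for \<open>t\<close> letters and \<open>r\<close> colours.
\<close>

definition hales_jewett_number :: "nat \<Rightarrow> nat \<Rightarrow> nat \<Rightarrow> bool"
  where "hales_jewett_number t r n \<longleftrightarrow>
    (\<forall>\<chi>. (\<forall>w. \<chi> w < r) \<longrightarrow> monochromatic_line \<chi> t n)"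

lemma hales_jewett_numberD:
  fixes \<chi> :: "nat list \<Rightarrow> 'c"
  assumes hj: "hales_jewett_number t (card C) n" and C: "finite C" "\<And>w. \<chi> w \<in> C"
  obtains v where "length v = n" "rigid t (Suc t) v"
    "\<And>a b. a < t \<Longrightarrow> b < t \<Longrightarrow> \<chi> (line t a v) = \<chi> (line t b v)"
proof -
  obtain f :: "'c \<Rightarrow> nat" where f: "inj_on f C" "\<And>c. c \<in> C \<Longrightarrow> f c < card C"
    using colour_code[OF C(1)] by metis
  have "\<forall>w. f (\<chi> w) < card C" using f(2) C(2) by blast
  from hj[unfolded hales_jewett_number_def monochromatic_line_def, rule_format, of "\<lambda>w. f (\<chi> w)", OF this[rule_format]]
  obtain v where v: "length v = n" "rigid t (Suc t) v"
    "\<forall>a<t. \<forall>b<t. f (\<chi> (line t a v)) = f (\<chi> (line t b v))"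
    by blast
  show thesis
    by (rule that[OF v(1,2)]) (use v(3) C(2) inj_onD[OF f(1)] in blast)
qed

text \<open>
  Colour focusing. To pass from \<open>k\<close> to \<open>k + 1\<close> focused lines, words are split into a left and
  a right part. The Hales--Jewett property for \<open>t\<close> letters, applied to the left part with functions
  of the right part as colours, yields a line \<open>v\<close> along which the letters below \<open>t\<close> are
  indistinguishable. The lines in the right part, prolonged by \<open>v\<close>, remain focused, and \<open>v\<close>
  followed by the old focus is a line of a new colour, unless a monochromatic line arises.
\<close>

lemma colour_focusing:
  fixes t r k :: nat
  assumes hj: "\<And>r. \<exists>n. hales_jewett_number t r n" and "0 < t"
  defines "T \<equiv> Suc t"
  shows "\<exists>n. \<forall>\<chi>. (\<forall>w. \<chi> w < r) \<longrightarrow> monochromatic_line \<chi> T n \<or> focused_lines \<chi> t n k"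
proof (induction k)
  case 0
  show ?case by (rule exI[of _ 0]) (auto simp: focused_lines_def)
next
  case (Suc k)
  then obtain n where n: "\<And>\<chi>. (\<And>w. \<chi> w < r) \<Longrightarrow>
      monochromatic_line \<chi> T n \<or> focused_lines \<chi> t n k"
    by blast
  define X where "X = {x. set x \<subseteq> {..<T} \<and> length x = n}"
  define C where "C = PiE X (\<lambda>_. {..<r})"
  have "finite X" unfolding X_def by (rule finite_lists_length_eq) simp
  then have C: "finite C" unfolding C_def by (intro finite_PiE) auto
  obtain n' where n': "hales_jewett_number t (card C) n'" using hj by blast
  show ?case
  proof (intro exI[of _ "n' + n"] allI impI)
    fix \<chi> :: "nat list \<Rightarrow> nat" assume \<chi>: "\<forall>w. \<chi> w < r"
    have mem: "restrict (\<lambda>x. \<chi> (y @ x)) X \<in> C" for y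
      using \<chi> by (simp add: C_def)
    obtain v where v: "length v = n'" "rigid t (Suc t) v"
      "\<And>a b. a < t \<Longrightarrow> b < t \<Longrightarrow>
        restrict (\<lambda>x. \<chi> (line t a v @ x)) X = restrict (\<lambda>x. \<chi> (line t b v @ x)) X"
      by (rule hales_jewett_numberD[OF n' C mem]) (rule that)
    have indep: "\<chi> (line t a v @ x) = \<chi> (line t 0 v @ x)" if "a < t" "x \<in> X" for a x
      using fun_cong[OF v(3)[of a 0], of x] that by auto
    (* The parameter of v becomes the letter T, so that v' is a line over T = t + 1 letters. *)
    define v' where "v' = map (\<lambda>c. if c = t then T else c) v"
    have "rigid T (T + 1) v'" unfolding v'_def
      by (rule rigid_rename[where t = t]) (use v in \<open>auto simp: T_def\<close>)
    then have v': "rigid T (Suc T) v'" by simp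
    have line_v': "line T a v' = line t a v" for a
      using rigid_set[OF v(2)] by (auto simp: v'_def line_def T_def)
    have T_app: "rigid T (Suc T) (v' @ y)" if "set y \<subseteq> {..<Suc T}" for y
      using rigid_append[OF v', of "Suc T" y] that by (simp add: rigid_self_iff)
    have T_set: "set y \<subseteq> {..<Suc T}" if "rigid T (Suc T) y" for y
      using rigid_set[OF that] by simp
    have line_in: "line T a y \<in> X" if "rigid T (Suc T) y" "length y = n" "a < T" for a y
      using set_line[OF that(1,3)] that by (auto simp: X_def)
    define \<chi>' where "\<chi>' x = \<chi> (line t 0 v @ x)" for x
    have shift: "\<chi> (line T a (v' @ y)) = \<chi>' (line T a y)"
      if "rigid T (Suc T) y" "length y = n" "a < t" for a y
    proof -
      have "a < T" using that by (simp add: T_def)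
      from indep[OF that(3) line_in[OF that(1,2) this]] show ?thesis
        by (simp add: \<chi>'_def line_append line_v')
    qed
    have "\<And>w. \<chi>' w < r" using \<chi> by (simp add: \<chi>'_def)
    then consider "monochromatic_line \<chi>' T n" | "focused_lines \<chi>' t n k"
      using n by blast
    then show "monochromatic_line \<chi> T (n' + n) \<or> focused_lines \<chi> t (n' + n) (Suc k)"
    proof cases
      case 1
      then obtain y where y: "length y = n" "rigid T (Suc T) y"
        "\<forall>a<T. \<forall>b<T. \<chi>' (line T a y) = \<chi>' (line T b y)"
        unfolding monochromatic_line_def by blast
      define z where "z = line t 0 v @ y"
      have "set (line t 0 v) \<subseteq> {..<T}"
        using set_line[OF v(2) \<open>0 < t\<close>] \<open>0 < t\<close> by (force simp: T_def)
      then have rz: "rigid T (Suc T) z"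
        using y(2) by (simp add: z_def rigid_letters_append)
      have "line T a (line t 0 v) = line t 0 v" for a
        using \<open>set (line t 0 v) \<subseteq> {..<T}\<close> unfolding line_def[of T] by (intro map_idI) auto
      then have col: "\<chi> (line T a z) = \<chi>' (line T a y)" for a
        by (simp add: z_def line_append \<chi>'_def)
      have "\<forall>a<T. \<forall>b<T. \<chi> (line T a z) = \<chi> (line T b z)"
        unfolding col by (rule y(3))
      moreover note rz
      moreover have "length z = n' + n" using y(1) v(1) by (simp add: z_def)
      ultimately show ?thesis unfolding monochromatic_line_def by blast
    next
      case 2
      then obtain U f where f: "length f = n" "set f \<subseteq> {..<T}"
        and inj: "inj_on (\<lambda>i. \<chi>' (line T 0 (U i))) {..<k}"
        and U: "\<forall>i<k. rigid T (Suc T) (U i) \<and> line T t (U i) = f \<and>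
          (\<forall>a<t. \<chi>' (line T a (U i)) = \<chi>' (line T 0 (U i)))"
        unfolding focused_lines_def T_def by blast
      have Ur: "rigid T (Suc T) (U i)" and Uf: "line T t (U i) = f" if "i < k" for i
        using U that by blast+
      have Uc: "\<chi>' (line T a (U i)) = \<chi>' (line T 0 (U i))" if "i < k" "a < t" for i a
        using U that by blast
      have lenU: "length (U i) = n" if "i < k" for i
        using Uf[OF that] f(1) length_line by metis
      have linef: "line T a f = f" for a
        using f unfolding line_def by (intro map_idI) auto
      have fX: "f \<in> X" using f by (simp add: X_def)
      show ?thesis
      proof (cases "\<exists>i<k. \<chi>' (line T 0 (U i)) = \<chi>' f")
        case True
        then obtain i where i: "i < k" "\<chi>' (line T 0 (U i)) = \<chi>' f" by blast
        have mono: "\<chi>' (line T a (U i)) = \<chi>' f" if "a < T" for a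
          using that i(2) Uf[OF i(1)] Uc[OF i(1), of a] by (cases "a = t") (simp_all add: T_def)
        define z where "z = line t 0 v @ U i"
        have s: "set (line t 0 v) \<subseteq> {..<T}"
          using set_line[OF v(2) \<open>0 < t\<close>] \<open>0 < t\<close> by (force simp: T_def)
        then have rz: "rigid T (Suc T) z"
          using Ur[OF i(1)] by (simp add: z_def rigid_letters_append)
        have "line T a (line t 0 v) = line t 0 v" for a
          using s unfolding line_def[of T] by (intro map_idI) auto
        then have "\<chi> (line T a z) = \<chi>' (line T a (U i))" for a
          by (simp add: z_def line_append \<chi>'_def)
        then have "\<forall>a<T. \<forall>b<T. \<chi> (line T a z) = \<chi> (line T b z)"
          using mono by simp
        moreover note rz
        moreover have "length z = n' + n" using lenU[OF i(1)] v(1) by (simp add: z_def)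
        ultimately show ?thesis unfolding monochromatic_line_def by blast
      next
        case False
        define U' where "U' i = v' @ (if i < k then U i else f)" for i
        define f' where "f' = line T t v' @ f"
        have new: "\<chi>' (line T 0 (U i)) \<noteq> \<chi>' f" "\<chi>' f \<noteq> \<chi>' (line T 0 (U i))" if "i < k" for i
          using False that by metis+
        have c1: "\<chi> (line T a (U' i)) = \<chi>' (line T 0 (U i))" if "i < k" "a < t" for a i
          using shift[OF Ur[OF that(1)] lenU[OF that(1)] that(2)] Uc[OF that] that(1)
          by (simp add: U'_def)
        have c2: "\<chi> (line T a (U' k)) = \<chi>' f" if "a < t" for a
          using indep[OF that fX] by (simp add: U'_def line_append linef line_v' \<chi>'_def)
        have r1: "rigid T (Suc T) (U' i)" if "i < Suc k" for i
          unfolding U'_def using T_set[OF Ur] f(2) that by (intro T_app) (auto simp: less_Suc_eq)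
        have r2: "line T t (U' i) = f'" if "i < Suc k" for i
          unfolding U'_def f'_def using Uf linef that by (simp add: line_append)
        have r3: "\<chi> (line T a (U' i)) = \<chi> (line T 0 (U' i))" if "i < Suc k" "a < t" for a i
        proof (cases "i = k")
          case True
          show ?thesis unfolding True c2[OF that(2)] c2[OF \<open>0 < t\<close>] ..
        next
          case False
          then have "i < k" using that by simp
          show ?thesis unfolding c1[OF \<open>i < k\<close> that(2)] c1[OF \<open>i < k\<close> \<open>0 < t\<close>] ..
        qed
        have r4: "inj_on (\<lambda>i. \<chi> (line T 0 (U' i))) {..<Suc k}"
        proof (rule inj_onI)
          fix i j assume ij: "i \<in> {..<Suc k}" "j \<in> {..<Suc k}"
            "\<chi> (line T 0 (U' i)) = \<chi> (line T 0 (U' j))"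
          show "i = j"
            using ij c1[OF _ \<open>0 < t\<close>, of i] c1[OF _ \<open>0 < t\<close>, of j] c2[OF \<open>0 < t\<close>]
              new[of i] new[of j] inj_onD[OF inj, of i j]
            by (cases "i = k"; cases "j = k") (simp_all add: less_Suc_eq)
        qed
        have r5: "length f' = n' + n" "set f' \<subseteq> {..<T}"
        proof -
          have "length v' = n'" using v(1) by (simp add: v'_def)
          moreover have "set (line t t v) \<subseteq> {..<T}"
            using set_line[OF v(2), of t T] by (simp add: T_def)
          ultimately show "length f' = n' + n" "set f' \<subseteq> {..<T}"
            using f v(1) by (simp_all add: f'_def line_v')
        qed
        have "\<forall>i<Suc k. rigid T (Suc T) (U' i) \<and> line T t (U' i) = f' \<and>
          (\<forall>a<t. \<chi> (line T a (U' i)) = \<chi> (line T 0 (U' i)))"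
          using r1 r2 r3 by blast
        with r4 r5 show ?thesis unfolding focused_lines_def T_def by blast
      qed
    qed
  qed
qed

theorem hales_jewett:
  assumes "0 < t"
  shows "\<exists>n. hales_jewett_number t r n"
  using assms
proof (induction t arbitrary: r rule: nat_induct_non_zero)
  case 1
  show ?case unfolding hales_jewett_number_def monochromatic_line_def
    by (intro exI[of _ 1] allI impI exI[of _ "[1]"]) auto
next
  case (Suc t)
  obtain n where n: "\<And>\<chi>. (\<forall>w. \<chi> w < r) \<Longrightarrow>
      monochromatic_line \<chi> (Suc t) n \<or> focused_lines \<chi> t n (Suc r)"
    using colour_focusing[OF Suc.IH Suc.hyps, of r "Suc r"] by blast
  have no_focus: "\<not> focused_lines \<chi> t n (Suc r)" if \<chi>: "\<forall>w. \<chi> w < r" for \<chi>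
  proof
    assume "focused_lines \<chi> t n (Suc r)"
    then obtain U :: "nat \<Rightarrow> nat list" where "inj_on (\<lambda>i. \<chi> (line (Suc t) 0 (U i))) {..<Suc r}"
      unfolding focused_lines_def by blast
    from card_inj_on_le[OF this, of "{..<r}"] \<chi> show False by auto
  qed
  show ?case unfolding hales_jewett_number_def using n no_focus by blast
qed

section \<open>A finite Carlson--Simpson theorem\<close>

lemma set_subst: "set x \<subseteq> {..<t} \<Longrightarrow> rigid t s u \<Longrightarrow> t + length x \<le> s \<Longrightarrow> set (subst t x u) \<subseteq> {..<t}"
  using rigid_subst[of t s u x t] by (simp add: rigid_self_iff)

text \<open>
  The word \<open>u\<close> has \<open>N\<close> parameters, and the colour of an instance \<open>subst t x u\<close>, cut before
  the first parameter without value, depends only on the number of values given.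
\<close>

definition length_determined :: "(nat list \<Rightarrow> nat) \<Rightarrow> nat \<Rightarrow> nat \<Rightarrow> nat list \<Rightarrow> bool"
  where "length_determined \<chi> t N u \<longleftrightarrow> rigid t (t + N) u \<and>
    (\<forall>x y. set x \<subseteq> {..<t} \<longrightarrow> set y \<subseteq> {..<t} \<longrightarrow> length x = length y \<longrightarrow> length x \<le> N \<longrightarrow>
      \<chi> (subst t x u) = \<chi> (subst t y u))"

lemma length_determinedD:
  assumes "length_determined \<chi> t N u" "set x \<subseteq> {..<t}" "set y \<subseteq> {..<t}"
    "length x = length y" "length x \<le> N"
  shows "\<chi> (subst t x u) = \<chi> (subst t y u)"
  using assms unfolding length_determined_def by blast

lemma subst_append_full:
  assumes "set u \<subseteq> {..<t + length x}"
  shows "subst t x (u @ v) = subst t x u @ subst t x v"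
proof -
  have app: "takeWhile (\<lambda>c. c < t + length x) (u @ v) = u @ takeWhile (\<lambda>c. c < t + length x) v"
    using assms by (intro takeWhile_append2) auto
  have all: "takeWhile (\<lambda>c. c < t + length x) u = u"
    using assms unfolding takeWhile_eq_all_conv by auto
  show ?thesis unfolding subst_def app all by simp
qed

text \<open>
  Induction on the number \<open>N\<close> of parameters: a line \<open>v\<close> is appended whose letters cannot be
  distinguished by the colouring, whatever of length at most \<open>L\<close> precedes it. The word \<open>u\<close> in
  front of it is obtained for a colouring that also records the colours after appending an instance of
  \<open>v\<close>, or the part \<open>v0\<close> of \<open>v\<close> before its parameter.
\<close>

lemma ex_length_determined:
  assumes "0 < t"
  shows "\<exists>L. \<forall>\<chi>. (\<forall>w. \<chi> w < r) \<longrightarrow> (\<exists>u. length u \<le> L \<and> length_determined \<chi> t N u)"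
proof (induction N arbitrary: r)
  case 0
  show ?case
    by (intro exI[of _ 0] allI impI exI[of _ "[]"]) (auto simp: length_determined_def)
next
  case (Suc N)
  define D where "D = {..<r} \<times> {..<r} \<times> {..<r}"
  have D: "finite D" by (simp add: D_def)
  obtain f where f: "inj_on f D" "\<And>c. c \<in> D \<Longrightarrow> f c < card D"
    using colour_code[OF D] by metis
  obtain L where L: "\<And>\<chi>. (\<forall>w. \<chi> w < card D) \<Longrightarrow> \<exists>u. length u \<le> L \<and> length_determined \<chi> t N u"
    using Suc by blast
  define Z where "Z = {z. set z \<subseteq> {..<t} \<and> length z \<le> L}"
  define C where "C = PiE Z (\<lambda>_. {..<r})"
  have "finite Z" unfolding Z_def by (rule finite_lists_length_le) simp
  then have C: "finite C" unfolding C_def by (intro finite_PiE) auto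
  obtain n where n: "hales_jewett_number t (card C) n" using hales_jewett[OF assms] by blast
  show ?case
  proof (intro exI[of _ "L + n"] allI impI)
    fix \<chi> :: "nat list \<Rightarrow> nat" assume \<chi>: "\<forall>w. \<chi> w < r"
    have mem: "restrict (\<lambda>z. \<chi> (z @ y)) Z \<in> C" for y
      using \<chi> by (simp add: C_def)
    obtain v where v: "length v = n" "rigid t (Suc t) v"
      and eq: "\<And>a b. a < t \<Longrightarrow> b < t \<Longrightarrow>
        restrict (\<lambda>z. \<chi> (z @ line t a v)) Z = restrict (\<lambda>z. \<chi> (z @ line t b v)) Z"
      by (rule hales_jewett_numberD[OF n C mem]) (rule that)
    have indep: "\<chi> (z @ line t a v) = \<chi> (z @ line t 0 v)" if "a < t" "z \<in> Z" for a z
      using fun_cong[OF eq[OF that(1) assms], of z] that by simp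
    define v0 where "v0 = takeWhile (\<lambda>c. c \<noteq> t) v"
    define \<chi>' where "\<chi>' z = f (\<chi> z, \<chi> (z @ v0), \<chi> (z @ line t 0 v))" for z
    have inD: "(\<chi> z, \<chi> (z @ v0), \<chi> (z @ line t 0 v)) \<in> D" for z
      using \<chi> by (simp add: D_def)
    then have "\<forall>w. \<chi>' w < card D" using f(2) by (simp add: \<chi>'_def)
    from L[OF this] obtain u where u: "length u \<le> L" "length_determined \<chi>' t N u" by blast
    then have ru: "rigid t (t + N) u" by (simp add: length_determined_def)
    have same: "\<chi> (subst t x u) = \<chi> (subst t y u)"
      "\<chi> (subst t x u @ v0) = \<chi> (subst t y u @ v0)"
      "\<chi> (subst t x u @ line t 0 v) = \<chi> (subst t y u @ line t 0 v)"
      if "set x \<subseteq> {..<t}" "set y \<subseteq> {..<t}" "length x = length y" "length x \<le> N" for x y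
    proof -
      have "\<chi>' (subst t x u) = \<chi>' (subst t y u)"
        by (rule length_determinedD[OF u(2) that])
      from inj_onD[OF f(1) this[unfolded \<chi>'_def] inD inD]
      show "\<chi> (subst t x u) = \<chi> (subst t y u)"
        "\<chi> (subst t x u @ v0) = \<chi> (subst t y u @ v0)"
        "\<chi> (subst t x u @ line t 0 v) = \<chi> (subst t y u @ line t 0 v)" by auto
    qed
    define g where "g c = (if c = t then t + N else c)" for c
    define u' where "u' = u @ map g v"
    have "rigid (t + N) (t + N + 1) (map g v)"
      by (rule rigid_rename[where t = t]) (use v assms in \<open>auto simp: g_def\<close>)
    then have rv: "rigid (t + N) (t + Suc N) (map g v)" by simp
    have ru': "rigid t (t + Suc N) u'"
      unfolding u'_def by (rule rigid_append[OF ru rv])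
    have setu: "set u \<subseteq> {..<t + N}" and setv: "set v \<subseteq> {..<Suc t}"
      using rigid_set[OF ru] rigid_set[OF v(2)] by auto
    have short: "subst t x u' = subst t x u" if "length x < N" for x
      unfolding u'_def by (rule subst_truncate[OF ru]) (use that in simp)
    have cut: "subst t x u' = subst t x u @ v0" if "length x = N" for x
    proof -
      have "map (letter_value t x) (takeWhile (\<lambda>c. c < t + N) (map g v)) = v0"
      proof -
        have "takeWhile (\<lambda>c. c < t + N) (map g v) = map g (takeWhile (\<lambda>c. g c < t + N) v)"
          by (simp add: takeWhile_map o_def)
        also have "takeWhile (\<lambda>c. g c < t + N) v = v0"
          unfolding v0_def using setv by (intro takeWhile_cong) (auto simp: g_def)
        finally have "takeWhile (\<lambda>c. c < t + N) (map g v) = map g v0" .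
        moreover have "letter_value t x (g c) = c" if "c \<in> set v0" for c
          using set_takeWhileD[OF that[unfolded v0_def]] setv
          by (auto simp: letter_value_def g_def subset_iff less_Suc_eq)
        ultimately show ?thesis by (simp add: map_idI)
      qed
      then have "subst t x (map g v) = v0" using that by (simp add: subst_def)
      then show ?thesis
        unfolding u'_def using setu that by (simp add: subst_append_full)
    qed
    have full: "subst t x u' = subst t (butlast x) u @ line t (last x) v" if "length x = Suc N" for x
    proof -
      obtain x' a where x: "x = x' @ [a]" "length x' = N"
        using \<open>length x = Suc N\<close> by (metis append_butlast_last_id length_butlast diff_Suc_1 list.size(3) nat.distinct(1))
      have s: "set (map g v) \<subseteq> {..<t + length x}" using setv x by (auto simp: g_def)
      have "letter_value t x (g c) = (if c = t then a else c)" if "c \<in> set v" for c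
        using that setv x by (auto simp: letter_value_def g_def nth_append)
      then have "subst t x (map g v) = line t a v"
        using s by (simp add: subst_full line_def)
      moreover have su: "set u \<subseteq> {..<t + length x}" "set u \<subseteq> {..<t + length x'}"
        using setu x by auto
      moreover have "subst t x u = subst t x' u"
        unfolding su[THEN subst_full] using su x by (auto simp: letter_value_def nth_append)
      ultimately show ?thesis unfolding u'_def using x by (simp add: subst_append_full)
    qed
    have "\<chi> (subst t x u') = \<chi> (subst t y u')"
      if xy: "set x \<subseteq> {..<t}" "set y \<subseteq> {..<t}" "length x = length y" "length x \<le> Suc N" for x y
    proof -
      consider "length x < N" | "length x = N" | "length x = Suc N" using xy by linarith
      then show ?thesis
      proof cases
        case 1
        then show ?thesis using short same(1)[of x y] xy by simp
      next
        case 2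
        then show ?thesis using cut same(2)[of x y] xy by simp
      next
        case 3
        have *: "\<chi> (subst t z u') = \<chi> (subst t (butlast z) u @ line t 0 v)"
          if z: "length z = Suc N" "set z \<subseteq> {..<t}" for z
        proof -
          have "set (subst t (butlast z) u) \<subseteq> {..<t}"
            using z by (intro set_subst[OF _ ru]) (auto dest: in_set_butlastD)
          moreover have "length (subst t (butlast z) u) \<le> L"
            using length_subst_le[of t "butlast z" u] u(1) by linarith
          moreover have "last z < t"
            using z last_in_set[of z] by (cases z) auto
          ultimately show ?thesis
            unfolding full[OF z(1)] by (intro indep) (simp_all add: Z_def)
        qed
        have "\<chi> (subst t (butlast x) u @ line t 0 v) = \<chi> (subst t (butlast y) u @ line t 0 v)"
          by (rule same(3)) (use xy 3 in \<open>auto dest: in_set_butlastD\<close>)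
        then show ?thesis using *[of x] *[of y] xy 3 by simp
      qed
    qed
    then have "length_determined \<chi> t (Suc N) u'"
      unfolding length_determined_def using ru' by blast
    moreover have "length u' \<le> L + n" using u(1) v(1) by (simp add: u'_def)
    ultimately show "\<exists>u. length u \<le> L + n \<and> length_determined \<chi> t (Suc N) u" by blast
  qed
qed

text \<open>
  Identifying consecutive parameters: the cut positions of the word \<open>q\<close> can be taken from any set
  \<open>P\<close> of more than \<open>l\<close> lengths.
\<close>

lemma ex_word_with_lengths:
  assumes "0 < t" "finite P" "l < card P"
  shows "\<exists>q. rigid t (t + l) q \<and> length q \<in> P \<and>
    (\<forall>x. set x \<subseteq> {..<t} \<longrightarrow> length x \<le> l \<longrightarrow> length (subst t x q) \<in> P)"
  using assms(2,3)
proof (induction l arbitrary: P)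
  case 0
  then obtain p where "p \<in> P" by (metis card.empty equals0I less_irrefl)
  moreover have "set (replicate p 0) \<subseteq> {..<t}" using assms(1) by auto
  then have "length (subst t [] (replicate p 0)) = p" "rigid t t (replicate p 0)"
    by (simp_all add: subst_full rigid_self_iff)
  ultimately show ?case by (intro exI[of _ "replicate p 0"]) auto
next
  case (Suc l)
  define M where "M = Max P"
  have "P \<noteq> {}" using Suc.prems by auto
  then have M: "M \<in> P" "\<And>p. p \<in> P \<Longrightarrow> p \<le> M" using Suc.prems by (auto simp: M_def)
  have "l < card (P - {M})" "finite (P - {M})" using Suc.prems M by auto
  from Suc.IH[OF this(2,1)] obtain q where q: "rigid t (t + l) q" "length q \<in> P - {M}"
    "\<And>x. set x \<subseteq> {..<t} \<Longrightarrow> length x \<le> l \<Longrightarrow> length (subst t x q) \<in> P - {M}" by blast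
  have less: "length q < M" using q(2) M(2)[of "length q"] by auto
  define e where "e = replicate (M - length q) (t + l)"
  have e: "e = (t + l) # replicate (M - length q - 1) (t + l)"
    using less by (simp add: e_def flip: replicate_Suc)
  have "rigid (t + l) (t + Suc l) e"
    unfolding e by (auto simp: rigid_self_iff)
  then have "rigid t (t + Suc l) (q @ e)" by (rule rigid_append[OF q(1)])
  moreover have len: "length (q @ e) = M" using less by (simp add: e_def)
  moreover have "length (subst t x (q @ e)) \<in> P" if x: "set x \<subseteq> {..<t}" "length x \<le> Suc l" for x
  proof -
    consider "length x < l" | "length x = l" | "length x = Suc l" using x by linarith
    then show ?thesis
    proof cases
      case 1
      then show ?thesis using q(3)[OF x(1)] subst_truncate[OF q(1), of x e] by simp
    next
      case 2
      then have "subst t x e = []" by (simp add: e subst_def)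
      then show ?thesis using q(3)[OF x(1)] 2 rigid_set[OF q(1)] by (simp add: subst_append_full)
    next
      case 3
      have "set (q @ e) \<subseteq> {..<t + length x}" using rigid_set[OF q(1)] 3 by (auto simp: e_def)
      then show ?thesis using len M by (simp add: subst_full)
    qed
  qed
  ultimately show ?case using M by (intro exI[of _ "q @ e"]) simp
qed

text \<open>
  A finite form of the Carlson--Simpson theorem. Once the colour depends on the length only, the
  pigeonhole principle provides more than \<open>l\<close> lengths of the same colour.
\<close>

theorem carlson_simpson:
  assumes "0 < t"
  shows "\<exists>L. \<forall>\<chi>. (\<forall>w. \<chi> w < r) \<longrightarrow>
    (\<exists>u c. length u \<le> L \<and> rigid t (t + l) u \<and>
      (\<forall>x. set x \<subseteq> {..<t} \<longrightarrow> length x \<le> l \<longrightarrow> \<chi> (subst t x u) = (c :: nat)))"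
proof -
  define N where "N = r * l"
  obtain L where L: "\<And>\<chi>. (\<forall>w. \<chi> w < r) \<Longrightarrow> \<exists>u. length u \<le> L \<and> length_determined \<chi> t N u"
    using ex_length_determined[OF assms] by blast
  show ?thesis
  proof (intro exI[of _ L] allI impI)
    fix \<chi> :: "nat list \<Rightarrow> nat" assume \<chi>: "\<forall>w. \<chi> w < r"
    from L[OF this] obtain u where u: "length u \<le> L" "length_determined \<chi> t N u" by blast
    then have ru: "rigid t (t + N) u" by (simp add: length_determined_def)
    define \<gamma> where "\<gamma> p = \<chi> (subst t (replicate p 0) u)" for p
    have \<gamma>: "\<chi> (subst t x u) = \<gamma> (length x)" if "set x \<subseteq> {..<t}" "length x \<le> N" for x
      unfolding \<gamma>_def by (rule length_determinedD[OF u(2)]) (use that assms in auto)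
    obtain c where c: "l < card {p \<in> {..N}. \<gamma> p = c}"
    proof (rule ccontr)
      assume "\<not> thesis"
      with that have le: "card {p \<in> {..N}. \<gamma> p = c} \<le> l" for c by (metis not_le)
      have "{..N} = (\<Union>c<r. {p \<in> {..N}. \<gamma> p = c})" using \<chi> by (auto simp: \<gamma>_def)
      then have "card {..N} \<le> (\<Sum>c<r. card {p \<in> {..N}. \<gamma> p = c})"
        by (metis card_UN_le finite_lessThan)
      also have "\<dots> \<le> (\<Sum>c<r. l)" by (rule sum_mono) (rule le)
      finally show False by (simp add: N_def)
    qed
    from ex_word_with_lengths[OF assms _ c] obtain q where q: "rigid t (t + l) q"
      "length q \<in> {p \<in> {..N}. \<gamma> p = c}"
      "\<And>x. set x \<subseteq> {..<t} \<Longrightarrow> length x \<le> l \<Longrightarrow> length (subst t x q) \<in> {p \<in> {..N}. \<gamma> p = c}"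
      by auto
    have "rigid t (t + l) (subst t q u)"
      by (rule rigid_subst[OF ru]) (use q in auto)
    moreover have "length (subst t q u) \<le> L" using length_subst_le[of t q u] u(1) by linarith
    moreover have "\<chi> (subst t x (subst t q u)) = c" if x: "set x \<subseteq> {..<t}" "length x \<le> l" for x
      using q(3)[OF x] \<gamma>[of "subst t x q"] set_subst[OF x(1) q(1)] x
      by (simp flip: subst_subst[OF ru])
    ultimately show "\<exists>u c. length u \<le> L \<and> rigid t (t + l) u \<and>
        (\<forall>x. set x \<subseteq> {..<t} \<longrightarrow> length x \<le> l \<longrightarrow> \<chi> (subst t x u) = c)"
      by blast
  qed
qed

section \<open>The Graham--Rothschild theorem and rigid surjections\<close>

text \<open>
  Words of length \<open>n\<close> suffice for the Graham--Rothschild theorem for \<open>t\<close> letters and \<open>r\<close>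
  colours: if the \<open>m\<close>-parameter words are coloured, some \<open>l\<close>-parameter word has all its
  \<open>m\<close>-parameter instances in one colour.
\<close>

definition graham_rothschild_number :: "nat \<Rightarrow> nat \<Rightarrow> nat \<Rightarrow> nat \<Rightarrow> nat \<Rightarrow> bool"
  where "graham_rothschild_number t m l r n \<longleftrightarrow>
    (\<forall>\<chi>. (\<forall>w. \<chi> w < r) \<longrightarrow>
      (\<exists>u. length u = n \<and> rigid t (t + l) u \<and>
        (\<forall>w w'. length w = l \<longrightarrow> length w' = l \<longrightarrow> rigid t (t + m) w \<longrightarrow> rigid t (t + m) w' \<longrightarrow>
          \<chi> (subst t w u) = (\<chi> (subst t w' u) :: nat))))"

lemma graham_rothschild_numberD:
  fixes \<chi> :: "nat list \<Rightarrow> 'c"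
  assumes gr: "graham_rothschild_number t m l (card C) n" and C: "finite C" "\<And>w. \<chi> w \<in> C"
  obtains u where "length u = n" "rigid t (t + l) u"
    "\<And>w w'. length w = l \<Longrightarrow> length w' = l \<Longrightarrow> rigid t (t + m) w \<Longrightarrow> rigid t (t + m) w' \<Longrightarrow>
      \<chi> (subst t w u) = \<chi> (subst t w' u)"
proof -
  obtain f :: "'c \<Rightarrow> nat" where f: "inj_on f C" "\<And>c. c \<in> C \<Longrightarrow> f c < card C"
    using colour_code[OF C(1)] by metis
  have "\<forall>w. f (\<chi> w) < card C" using f(2) C(2) by blast
  from gr[unfolded graham_rothschild_number_def, rule_format, of "\<lambda>w. f (\<chi> w)", OF this[rule_format]]
  obtain u where u: "length u = n" "rigid t (t + l) u"
    "\<forall>w w'. length w = l \<longrightarrow> length w' = l \<longrightarrow> rigid t (t + m) w \<longrightarrow> rigid t (t + m) w' \<longrightarrow>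
      f (\<chi> (subst t w u)) = f (\<chi> (subst t w' u))"
    by blast
  show thesis
    by (rule that[OF u(1,2)]) (use u(3) C(2) inj_onD[OF f(1)] in blast)
qed

text \<open>
  The word \<open>u\<close> has \<open>L + l\<close> parameters. For its complete instances by words \<open>x @ t # w\<close>
  whose first parameter \<open>t\<close> occurs at a position below \<open>L\<close>, the colour depends only on the part \<open>x\<close> before it. After that position \<open>t\<close>
  counts as a letter, so \<open>w\<close> is a word over \<open>t + 1\<close> letters.
\<close>

definition prefix_determined :: "(nat list \<Rightarrow> nat) \<Rightarrow> nat \<Rightarrow> nat \<Rightarrow> nat \<Rightarrow> nat \<Rightarrow> nat list \<Rightarrow> bool"
  where "prefix_determined \<chi> t m L l u \<longleftrightarrow> rigid t (t + L + l) u \<and>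
    (\<forall>x w w'. set x \<subseteq> {..<t} \<longrightarrow> length x < L \<longrightarrow>
      length (x @ t # w) = L + l \<longrightarrow> length (x @ t # w') = L + l \<longrightarrow>
      rigid (Suc t) (Suc t + m) w \<longrightarrow> rigid (Suc t) (Suc t + m) w' \<longrightarrow>
      \<chi> (subst t (x @ t # w) u) = \<chi> (subst t (x @ t # w') u))"

lemma prefix_determinedD:
  assumes "prefix_determined \<chi> t m L l u" "set x \<subseteq> {..<t}" "length x < L"
    "length (x @ t # w) = L + l" "length (x @ t # w') = L + l"
    "rigid (Suc t) (Suc t + m) w" "rigid (Suc t) (Suc t + m) w'"
  shows "\<chi> (subst t (x @ t # w) u) = \<chi> (subst t (x @ t # w') u)"
  using assms unfolding prefix_determined_def by blast

text \<open>
  Fusion: the positions \<open>0, 1, \<dots>, L - 1\<close> are treated one after the other. The word \<open>u\<close> found for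
  the positions below \<open>L\<close> has \<open>Suc k\<close> further parameters; the first of them is kept, and the
  remaining \<open>k\<close> are specialised to a word \<open>v\<close> with \<open>l\<close> parameters that is homogeneous for the
  colouring by functions of the prefix of length \<open>L\<close>.
\<close>

lemma ex_prefix_determined:
  assumes gr: "\<And>l r. \<exists>n. graham_rothschild_number (Suc t) m l r n"
  shows "\<exists>n. \<forall>\<chi>. (\<forall>w. \<chi> w < r) \<longrightarrow> (\<exists>u. length u = n \<and> prefix_determined \<chi> t m L l u)"
proof (induction L arbitrary: l)
  case 0
  show ?case
    by (intro exI[of _ l] allI impI exI[of _ "[t..<t + l]"])
       (simp add: prefix_determined_def rigid_upt)
next
  case (Suc L)
  define X where "X = {x. set x \<subseteq> {..<t} \<and> length x = L}"
  define C where "C = PiE X (\<lambda>_. {..<r})"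
  have "finite X" unfolding X_def by (rule finite_lists_length_eq) simp
  then have C: "finite C" unfolding C_def by (intro finite_PiE) auto
  obtain k where k: "graham_rothschild_number (Suc t) m l (card C) k" using gr by blast
  obtain n where n: "\<And>\<chi>. (\<forall>w. \<chi> w < r) \<Longrightarrow> \<exists>u. length u = n \<and> prefix_determined \<chi> t m L (Suc k) u"
    using Suc by blast
  show ?case
  proof (intro exI[of _ n] allI impI)
    fix \<chi> :: "nat list \<Rightarrow> nat" assume \<chi>: "\<forall>w. \<chi> w < r"
    from n[OF this] obtain u where u: "length u = n" "prefix_determined \<chi> t m L (Suc k) u" by blast
    then have ru: "rigid t (t + L + Suc k) u" by (simp add: prefix_determined_def)
    have mem: "restrict (\<lambda>x. \<chi> (subst t (x @ t # y) u)) X \<in> C" for y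
      using \<chi> by (simp add: C_def)
    obtain v where v: "length v = k" "rigid (Suc t) (Suc t + l) v"
      and eq: "\<And>w w'. length w = l \<Longrightarrow> length w' = l \<Longrightarrow>
        rigid (Suc t) (Suc t + m) w \<Longrightarrow> rigid (Suc t) (Suc t + m) w' \<Longrightarrow>
        restrict (\<lambda>x. \<chi> (subst t (x @ t # subst (Suc t) w v) u)) X =
        restrict (\<lambda>x. \<chi> (subst t (x @ t # subst (Suc t) w' v) u)) X"
      by (rule graham_rothschild_numberD[OF k C mem]) (rule that)
    (* Over t + 1 letters, the letter t of v stands for the parameter t + L of u. *)
    define g where "g c = (if c < t then c else c + L)" for c
    define q where "q = [t..<t + Suc L] @ map g v"
    have "rigid (t + Suc L) (t + Suc L + l) (map g v)"
      by (rule rigid_rename[OF v(2)]) (auto simp: g_def)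
    then have rq: "rigid t (t + Suc L + l) q"
      unfolding q_def by (intro rigid_append[OF rigid_upt]) auto
    have lq: "length q = L + Suc k" using v(1) by (simp add: q_def)
    define u' where "u' = subst t q u"
    have ru': "rigid t (t + Suc L + l) u'"
      unfolding u'_def by (rule rigid_subst[OF ru _ rq]) (simp add: lq)
    have lu': "length u' = n"
    proof -
      have "set u \<subseteq> {..<t + length q}" using rigid_set[OF ru] lq by (simp add: add.assoc)
      then show ?thesis using u(1) by (simp add: u'_def subst_full)
    qed
    have sq: "subst t z q = take (Suc L) z @ map (letter_value t z) (map g v)" if z: "length z = Suc L + l" for z
    proof -
      have "subst t z q = map (letter_value t z) q"
        by (rule subst_full) (use rigid_set[OF rq] z in \<open>simp add: add.assoc\<close>)
      moreover have "map (letter_value t z) [t..<t + Suc L] = take (Suc L) z"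
        using z by (intro nth_equalityI) (auto simp: letter_value_def simp del: upt_Suc)
      ultimately show ?thesis by (simp add: q_def)
    qed
    have step: "\<chi> (subst t (x @ t # w) u') = \<chi> (subst t (x @ t # w') u')"
      if a: "set x \<subseteq> {..<t}" "length x < Suc L"
        "length (x @ t # w) = Suc L + l" "length (x @ t # w') = Suc L + l"
        "rigid (Suc t) (Suc t + m) w" "rigid (Suc t) (Suc t + m) w'" for x w w'
    proof (cases "length x = L")
      case True
      have *: "subst t (x @ t # z) u' = subst t (x @ t # subst (Suc t) z v) u"
        if z: "length z = l" for z
      proof -
        have "letter_value t (x @ t # z) (g c) = letter_value (Suc t) z c" if "c \<in> set v" for c
        proof -
          consider "c < t" | "c = t" | d where "c = Suc t + d"
            using less_imp_Suc_add[of t c] by fastforce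
          then show ?thesis using True by cases (simp_all add: letter_value_def g_def nth_append)
        qed
        then have "map (letter_value t (x @ t # z)) (map g v) = subst (Suc t) z v"
          using rigid_set[OF v(2)] z by (simp add: subst_full)
        then have "subst t (x @ t # z) q = x @ t # subst (Suc t) z v"
          using sq[of "x @ t # z"] z True by simp
        then show ?thesis unfolding u'_def subst_subst[OF ru, symmetric] by simp
      qed
      have "x \<in> X" using True a(1) by (simp add: X_def)
      have len: "length w = l" "length w' = l" using a(3,4) True by auto
      from fun_cong[OF eq[OF len a(5,6)], of x] \<open>x \<in> X\<close>
      show ?thesis unfolding *[OF len(1)] *[OF len(2)] by simp
    next
      case False
      then have xl: "length x < L" using a by simp
      have *: "\<exists>y. subst t (x @ t # z) q = x @ t # y \<and> length (x @ t # y) = L + Suc k \<and>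
          rigid (Suc t) (Suc t + m) y"
        if z: "length (x @ t # z) = Suc L + l" "rigid (Suc t) (Suc t + m) z" for z
      proof -
        have initial: "take (Suc L) (x @ t # z) = x @ t # take (L - length x) z"
          using xl by (simp add: Suc_diff_le take_Cons')
        obtain y where y: "subst t (x @ t # z) q = x @ t # y"
          unfolding sq[OF z(1)] initial by simp
        have "rigid t (Suc t + m) (x @ t # z)"
          using z(2) a(1) by (simp add: rigid_letters_append)
        then have "rigid t (Suc t + m) (subst t (x @ t # z) q)"
          using z(1) by (intro rigid_subst[OF rq]) auto
        then have "rigid (Suc t) (Suc t + m) y"
          using a(1) by (simp add: y rigid_letters_append)
        moreover have "length (subst t (x @ t # z) q) = length q"
        proof -
          have "set q \<subseteq> {..<t + length (x @ t # z)}"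
            using rigid_set[OF rq] z(1) by (simp add: add.assoc)
          then show ?thesis by (simp add: subst_full)
        qed
        ultimately show ?thesis using y lq by (intro exI[of _ y]) simp
      qed
      from *[OF a(3,5)] obtain y where y: "subst t (x @ t # w) q = x @ t # y"
        "length (x @ t # y) = L + Suc k" "rigid (Suc t) (Suc t + m) y" by blast
      from *[OF a(4,6)] obtain y' where y': "subst t (x @ t # w') q = x @ t # y'"
        "length (x @ t # y') = L + Suc k" "rigid (Suc t) (Suc t + m) y'" by blast
      have "\<chi> (subst t (x @ t # y) u) = \<chi> (subst t (x @ t # y') u)"
        by (rule prefix_determinedD[OF u(2) a(1) xl y(2) y'(2) y(3) y'(3)])
      then show ?thesis unfolding u'_def subst_subst[OF ru, symmetric] y(1) y'(1) .
    qed
    have "prefix_determined \<chi> t m (Suc L) l u'"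
      unfolding prefix_determined_def using ru' step by blast
    then show "\<exists>u. length u = n \<and> prefix_determined \<chi> t m (Suc L) l u" using lu' by blast
  qed
qed

text \<open>
  Without parameters in the coloured words, the Carlson--Simpson theorem applies to complete
  instances; padding with the letter \<open>0\<close> makes the length independent of the colouring.
\<close>

lemma graham_rothschild_letters:
  assumes "0 < t"
  shows "\<exists>n. graham_rothschild_number t 0 l r n"
proof -
  obtain L where L: "\<And>\<chi>. (\<forall>w. \<chi> w < r) \<Longrightarrow>
    \<exists>u c. length u \<le> L \<and> rigid t (t + l) u \<and>
      (\<forall>x. set x \<subseteq> {..<t} \<longrightarrow> length x \<le> l \<longrightarrow> \<chi> (subst t x u) = (c :: nat))"
    using carlson_simpson[OF assms] by blast
  show ?thesis unfolding graham_rothschild_number_def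
  proof (intro exI[of _ L] allI impI)
    fix \<chi> :: "nat list \<Rightarrow> nat" assume \<chi>: "\<forall>w. \<chi> w < r"
    define \<chi>' where "\<chi>' w = \<chi> (w @ replicate (L - length w) 0)" for w
    have "\<forall>w. \<chi>' w < r" using \<chi> by (simp add: \<chi>'_def)
    from L[OF this] obtain u c where u: "length u \<le> L" "rigid t (t + l) u"
      "\<And>x. set x \<subseteq> {..<t} \<Longrightarrow> length x \<le> l \<Longrightarrow> \<chi>' (subst t x u) = c" by blast
    define z :: "nat list" where "z = replicate (L - length u) 0"
    have z: "set z \<subseteq> {..<t}" using assms by (auto simp: z_def)
    have "rigid t (t + l) (u @ z)"
      by (rule rigid_append[OF u(2)]) (use z in \<open>auto simp: rigid_self_iff\<close>)
    moreover have "\<chi> (subst t w (u @ z)) = c" if w: "length w = l" "rigid t t w" for w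
    proof -
      have s: "set u \<subseteq> {..<t + length w}" using rigid_set[OF u(2)] w by simp
      have "subst t w z = z"
        using z assms by (subst subst_full) (auto simp: letter_value_def intro!: map_idI)
      then have "subst t w (u @ z) = subst t w u @ z" by (simp add: subst_append_full[OF s])
      moreover have "length (subst t w u) = length u" by (simp add: subst_full[OF s])
      ultimately have "\<chi> (subst t w (u @ z)) = \<chi>' (subst t w u)" by (simp add: \<chi>'_def z_def)
      also have "\<dots> = c" using u(3) w by (simp add: rigid_self_iff)
      finally show ?thesis .
    qed
    moreover have "length (u @ z) = L" using u(1) by (simp add: z_def)
    ultimately show "\<exists>u. length u = L \<and> rigid t (t + l) u \<and>
        (\<forall>w w'. length w = l \<longrightarrow> length w' = l \<longrightarrow> rigid t (t + 0) w \<longrightarrow> rigid t (t + 0) w' \<longrightarrow>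
          \<chi> (subst t w u) = \<chi> (subst t w' u))"
      by (intro exI[of _ "u @ z"]) simp
  qed
qed

text \<open>
  After fusion the colour depends only on the part before the first parameter. The resulting colouring
  \<open>\<gamma>\<close> of words over \<open>t\<close> letters is made constant by the Carlson--Simpson theorem.
\<close>

theorem graham_rothschild:
  assumes "0 < t"
  shows "\<exists>n. graham_rothschild_number t m l r n"
  using assms
proof (induction m arbitrary: t l r)
  case 0
  then show ?case by (rule graham_rothschild_letters)
next
  case (Suc m)
  obtain K where K: "\<And>\<chi>. (\<forall>w. \<chi> w < r) \<Longrightarrow>
    \<exists>u c. length u \<le> K \<and> rigid t (t + l) u \<and>
      (\<forall>x. set x \<subseteq> {..<t} \<longrightarrow> length x \<le> l \<longrightarrow> \<chi> (subst t x u) = (c :: nat))"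
    using carlson_simpson[OF Suc.prems] by blast
  define L where "L = Suc K"
  have "\<exists>n. graham_rothschild_number (Suc t) m l r n" for l r by (rule Suc.IH) simp
  from ex_prefix_determined[OF this] obtain n where
    n: "\<And>\<chi>. (\<forall>w. \<chi> w < r) \<Longrightarrow> \<exists>u. length u = n \<and> prefix_determined \<chi> t m L 0 u" by blast
  show ?case unfolding graham_rothschild_number_def
  proof (intro exI[of _ n] allI impI)
    fix \<chi> :: "nat list \<Rightarrow> nat" assume \<chi>: "\<forall>w. \<chi> w < r"
    from n[OF this] obtain u where u: "length u = n" "prefix_determined \<chi> t m L 0 u" by blast
    then have ru: "rigid t (t + L) u" by (simp add: prefix_determined_def)
    define good where "good x w \<longleftrightarrow> length (x @ t # w) = L \<and> rigid (Suc t) (Suc t + m) w" for x w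
    define \<gamma> where "\<gamma> x = \<chi> (subst t (x @ t # (SOME w. good x w)) u)" for x
    have \<gamma>: "\<chi> (subst t (x @ t # w) u) = \<gamma> x" if x: "set x \<subseteq> {..<t}" and w: "good x w" for x w
    proof -
      have "good x (SOME w. good x w)" using w by (rule someI)
      with x w show ?thesis unfolding \<gamma>_def good_def
        by (intro prefix_determinedD[OF u(2)]) auto
    qed
    have "\<forall>x. \<gamma> x < r" using \<chi> by (simp add: \<gamma>_def)
    from K[OF this] obtain v c where v: "length v \<le> K" "rigid t (t + l) v"
      "\<And>x. set x \<subseteq> {..<t} \<Longrightarrow> length x \<le> l \<Longrightarrow> \<gamma> (subst t x v) = c" by blast
    define q where "q = v @ replicate (L - length v) 0"
    have lq: "length q = L" using v(1) by (simp add: q_def L_def)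
    have rq: "rigid t (t + l) q" unfolding q_def
      by (rule rigid_append[OF v(2)]) (use Suc.prems in \<open>auto simp: rigid_self_iff\<close>)
    define u' where "u' = subst t q u"
    have "rigid t (t + l) u'"
      unfolding u'_def by (rule rigid_subst[OF ru _ rq]) (simp add: lq)
    moreover have "length u' = n"
      using rigid_set[OF ru] u(1) lq by (simp add: u'_def subst_full)
    moreover have "\<chi> (subst t w u') = c" if w: "length w = l" "rigid t (t + Suc m) w" for w
    proof -
      from rigid_first_parameter[OF w(2)] obtain x y where
        xy: "w = x @ t # y" "set x \<subseteq> {..<t}" "rigid (Suc t) (t + Suc m) y" by auto
      have lx: "t + length x < t + l" using w xy by simp
      from subst_split[OF rq lx, of t y] obtain z where z: "subst t w q = subst t x q @ t # z"
        using xy by blast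
      have xq: "subst t x q = subst t x v"
        unfolding q_def by (rule subst_truncate[OF v(2) lx])
      have s: "set (subst t x q) \<subseteq> {..<t}" using lx by (intro set_subst[OF xy(2) rq]) simp
      have "rigid t (t + Suc m) (subst t w q)"
        by (rule rigid_subst[OF rq _ w(2)]) (simp add: w(1))
      then have "rigid (Suc t) (Suc t + m) z"
        using s by (simp add: z rigid_letters_append)
      moreover have "length (subst t w q) = L"
        using rigid_set[OF rq] w(1) lq by (simp add: subst_full)
      ultimately have "good (subst t x q) z" unfolding good_def z by simp
      from \<gamma>[OF s this] have "\<chi> (subst t (subst t w q) u) = \<gamma> (subst t x q)" by (simp add: z)
      also have "\<dots> = c" unfolding xq using v(3) xy lx by simp
      finally show ?thesis unfolding u'_def subst_subst[OF ru, symmetric] .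
    qed
    ultimately show "\<exists>u. length u = n \<and> rigid t (t + l) u \<and>
        (\<forall>w w'. length w = l \<longrightarrow> length w' = l \<longrightarrow> rigid t (t + Suc m) w \<longrightarrow>
          rigid t (t + Suc m) w' \<longrightarrow> \<chi> (subst t w u) = \<chi> (subst t w' u))"
      by (intro exI[of _ u']) simp
  qed
qed

text \<open>
  The dual Ramsey theorem: rigid surjections from \<open>{..<n}\<close> onto \<open>{..<K}\<close> are coloured, and \<open>u\<close>
  is a rigid surjection onto \<open>{..<L}\<close> all of whose composites with rigid surjections \<open>w\<close> from
  \<open>{..<L}\<close> onto \<open>{..<K}\<close> have the same colour.
  A word \<open>w\<close> with \<open>rigid 0 K w\<close> starts with \<open>0\<close>, and the rest is a \<open>(K - 1)\<close>-parameter
  word over the one-letter alphabet \<open>{0}\<close>.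
\<close>

corollary dual_ramsey:
  assumes "0 < K" "0 < L"
  shows "\<exists>n. \<forall>\<chi>. (\<forall>w. \<chi> w < r) \<longrightarrow>
    (\<exists>u. length u = n \<and> rigid 0 L u \<and>
      (\<forall>w w'. length w = L \<longrightarrow> length w' = L \<longrightarrow> rigid 0 K w \<longrightarrow> rigid 0 K w' \<longrightarrow>
        \<chi> (map ((!) w) u) = (\<chi> (map ((!) w') u) :: nat)))"
proof -
  obtain k l where KL: "K = Suc k" "L = Suc l" using assms by (metis gr0_implies_Suc)
  obtain n where n: "graham_rothschild_number 1 k l r n" using graham_rothschild[of 1 k l r] by (metis zero_less_one)
  show ?thesis
  proof (intro exI[of _ "Suc n"] allI impI)
    fix \<chi> :: "nat list \<Rightarrow> nat" assume \<chi>: "\<forall>w. \<chi> w < r"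
    then have "\<forall>w. \<chi> (0 # w) < r" by simp
    from n[unfolded graham_rothschild_number_def, rule_format, of "\<lambda>w. \<chi> (0 # w)", OF this[rule_format]]
    obtain u where u: "length u = n" "rigid 1 (1 + l) u"
      "\<forall>w w'. length w = l \<longrightarrow> length w' = l \<longrightarrow> rigid 1 (1 + k) w \<longrightarrow> rigid 1 (1 + k) w' \<longrightarrow>
        \<chi> (0 # subst 1 w u) = \<chi> (0 # subst 1 w' u)" by blast
    have *: "\<exists>v. w = 0 # v \<and> length v = l \<and> rigid 1 (1 + k) v \<and> map ((!) w) (0 # u) = 0 # subst 1 v u"
      if w: "length w = L" "rigid 0 K w" for w
    proof -
      obtain v where v: "w = 0 # v" "rigid 1 (1 + k) v" "length v = l"
        using w KL by (cases w) auto
      have "set u \<subseteq> {..<1 + length v}" using rigid_set[OF u(2)] v(3) by simp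
      then have "subst 1 v u = map (letter_value 1 v) u" by (rule subst_full)
      also have "\<dots> = map ((!) w) u" unfolding v(1) by (auto simp: letter_value_def nth_Cons')
      finally show ?thesis using v by auto
    qed
    show "\<exists>u. length u = Suc n \<and> rigid 0 L u \<and>
      (\<forall>w w'. length w = L \<longrightarrow> length w' = L \<longrightarrow> rigid 0 K w \<longrightarrow> rigid 0 K w' \<longrightarrow>
        \<chi> (map ((!) w) u) = \<chi> (map ((!) w') u))"
    proof (intro exI[of _ "0 # u"] conjI allI impI)
      fix w w' assume "length w = L" "length w' = L" "rigid 0 K w" "rigid 0 K w'"
      then show "\<chi> (map ((!) w) (0 # u)) = \<chi> (map ((!) w') (0 # u))"
        using *[of w] *[of w'] u(3) by metis
    qed (use u KL in auto)
  qed
qed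

lemma rigid_compose:
  assumes "rigid 0 L u" "rigid 0 K w" "length w = L"
  shows "rigid 0 K (map ((!) w) u)"
proof -
  have "subst 0 w u = map (letter_value 0 w) u"
    using rigid_set[OF assms(1)] assms(3) by (intro subst_full) simp
  moreover have "letter_value 0 w = (!) w" by (simp add: letter_value_def fun_eq_iff)
  ultimately show ?thesis using rigid_subst[OF assms(1) _ assms(2)] assms(3) by simp
qed

section \<open>An order on functions\<close>

lemma le_add_left: "(a :: 'm::distance_monoid) \<le> a + b"
  using add_mono_both[of a a 0 b] zero_least[of b] by simp

lemma le_add_right: "(a :: 'm::distance_monoid) \<le> b + a"
  using le_add_left[of a b] by (simp add: add.commute)

lemma ex_enumeration:
  fixes key :: "'a \<Rightarrow> nat"
  assumes "finite L" "inj_on key L"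
  obtains xs where "set xs = L" "\<And>p q. p < q \<Longrightarrow> q < length xs \<Longrightarrow> key (xs ! p) < key (xs ! q)"
proof
  define ks where "ks = sorted_list_of_set (key ` L)"
  define xs where "xs = map (the_inv_into L key) ks"
  have ks: "set ks = key ` L" "sorted_wrt (<) ks" using assms(1) by (simp_all add: ks_def)
  have "set xs = the_inv_into L key ` key ` L" by (simp add: xs_def ks)
  then show "set xs = L" using assms(2) by (simp add: the_inv_into_onto)
  show "key (xs ! p) < key (xs ! q)" if "p < q" "q < length xs" for p q
  proof -
    have key: "key (xs ! i) = ks ! i" if "i < length xs" for i
    proof -
      have i: "i < length ks" using that by (simp add: xs_def)
      then have "ks ! i \<in> key ` L" using ks(1) nth_mem by blast
      then show ?thesis using f_the_inv_into_f[OF assms(2)] i by (simp add: xs_def)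
    qed
    show ?thesis using key[of p] key[of q] sorted_wrt_nth_less[OF ks(2) that(1)] that
      by (simp add: xs_def)
  qed
qed

text \<open>
  Functions on \<open>{..<n}\<close> are lists of length \<open>n\<close>. They are compared at the largest value that
  either takes at an argument where they differ, and among the arguments where they differ and this
  value is taken, at the first one: the function having the value there is the larger.
\<close>

definition prec :: "'m::linorder list \<Rightarrow> 'm list \<Rightarrow> bool"
  where "prec f g \<longleftrightarrow> length f = length g \<and>
    (\<exists>i<length g. f ! i < g ! i \<and>
      (\<forall>j<length g. f ! j \<noteq> g ! j \<longrightarrow>
        f ! j < g ! i \<and> g ! j < g ! i \<or> f ! j \<le> g ! i \<and> g ! j \<le> g ! i \<and> i \<le> j))"

lemma prec_total:
  assumes "length f = length g" "f \<noteq> g"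
  shows "prec f g \<or> prec g f"
proof -
  define D where "D = {j. j < length g \<and> f ! j \<noteq> g ! j}"
  define m where "m = Max ((\<lambda>j. max (f ! j) (g ! j)) ` D)"
  define D' where "D' = {j \<in> D. max (f ! j) (g ! j) = m}"
  define i where "i = Min D'"
  have fin: "finite D" by (simp add: D_def)
  have "D \<noteq> {}" using assms by (auto simp: D_def list_eq_iff_nth_eq)
  then have "m \<in> (\<lambda>j. max (f ! j) (g ! j)) ` D" using fin by (auto simp: m_def)
  then have "D' \<noteq> {}" by (auto simp: D'_def)
  moreover have fin': "finite D'" using fin by (simp add: D'_def)
  ultimately have i: "i \<in> D'" unfolding i_def by (intro Min_in)
  have le: "max (f ! j) (g ! j) \<le> m" if "j \<in> D" for j
    unfolding m_def using fin that by (intro Max_ge) auto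
  have first: "f ! j < m \<and> g ! j < m \<or> f ! j \<le> m \<and> g ! j \<le> m \<and> i \<le> j" if "j \<in> D" for j
  proof (cases "j \<in> D'")
    case True
    then have "i \<le> j" using fin' by (simp add: i_def)
    then show ?thesis using le[OF that] by simp
  next
    case False
    then have "max (f ! j) (g ! j) \<noteq> m" using that by (simp add: D'_def)
    with le[OF that] have "max (f ! j) (g ! j) < m" by (rule le_neq_trans)
    then show ?thesis by simp
  qed
  have i': "i < length g" "f ! i \<noteq> g ! i" "max (f ! i) (g ! i) = m"
    using i by (auto simp: D'_def D_def)
  then consider "f ! i < g ! i" "g ! i = m" | "g ! i < f ! i" "f ! i = m"
    by (auto simp: max_def split: if_splits)
  then show ?thesis
  proof cases
    case 1
    then have "prec f g" unfolding prec_def using assms(1) i'(1) first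
      by (intro conjI exI[of _ i]) (auto simp: D_def)
    then show ?thesis ..
  next
    case 2
    then have "g ! j < f ! i \<and> f ! j < f ! i \<or> g ! j \<le> f ! i \<and> f ! j \<le> f ! i \<and> i \<le> j"
      if "j < length f" "g ! j \<noteq> f ! j" for j
      using first[of j] that assms(1) by (auto simp: D_def)
    then have "prec g f" unfolding prec_def using assms(1) i'(1) 2
      by (intro conjI exI[of _ i]) auto
    then show ?thesis ..
  qed
qed

text \<open>
  For functions with values in a finite set, \<open>prec\<close> is the order of binary numbers. Each
  argument contributes a power of two; its exponent is the position of the pair of value and argument
  in the lexicographic order in which larger values come later and, for equal values, smaller arguments
  come later.
\<close>

definition key :: "'m::linorder set \<Rightarrow> 'm list \<Rightarrow> nat"
  where "key V f = (\<Sum>j<length f. 2 ^ (card {w \<in> V. w < f ! j} * length f + (length f - Suc j)))"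

lemma prec_key_less:
  assumes V: "finite V" "set f \<subseteq> V" and "prec f g"
  shows "key V f < key V g"
proof -
  define n where "n = length g"
  from \<open>prec f g\<close> obtain i where n: "length f = n" and i: "i < n" "f ! i < g ! i"
    and max: "\<And>j. j < n \<Longrightarrow> f ! j \<noteq> g ! j \<Longrightarrow> f ! j < g ! i \<or> f ! j \<le> g ! i \<and> i \<le> j"
    unfolding prec_def n_def by blast
  define rank where "rank x = card {w \<in> V. w < x}" for x
  define e where "e x j = rank x * n + (n - Suc j)" for x j
  have fV: "f ! j \<in> V" if "j < n" for j using that n V(2) nth_mem by blast
  have rank_less: "rank x < rank y" if "x \<in> V" "x < y" for x y
    unfolding rank_def using V(1) that by (intro psubset_card_mono) auto
  have e_less: "e x j < e y k" if "rank x < rank y" "j < n" for x y j k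
  proof -
    have "e x j < rank x * n + n" using that by (simp add: e_def)
    also have "\<dots> = Suc (rank x) * n" by simp
    also have "\<dots> \<le> rank y * n" using that by (intro mult_le_mono1) simp
    finally show ?thesis by (simp add: e_def)
  qed
  define D where "D = {j. j < n \<and> f ! j \<noteq> g ! j}"
  have iD: "i \<in> D" using i by (auto simp: D_def)
  have inj: "inj_on (\<lambda>j. e (f ! j) j) D"
  proof (rule inj_onI)
    fix j k assume jk: "j \<in> D" "k \<in> D" "e (f ! j) j = e (f ! k) k"
    then have r: "rank (f ! j) = rank (f ! k)"
      using e_less[of "f ! j" "f ! k" j k] e_less[of "f ! k" "f ! j" k j] by (force simp: D_def)
    have "n - Suc j = n - Suc k" using jk(3) unfolding e_def r by simp
    then show "j = k" using jk by (auto simp: D_def)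
  qed
  have below: "e (f ! j) j < e (g ! i) i" if "j \<in> D" for j
  proof (cases "f ! j < g ! i")
    case True
    then show ?thesis using that fV by (intro e_less rank_less) (auto simp: D_def)
  next
    case False
    then have "f ! j = g ! i" "i \<le> j" using max[of j] that by (auto simp: D_def)
    moreover from this have "i \<noteq> j" using i by auto
    ultimately show ?thesis using that by (auto simp: e_def D_def)
  qed
  have "(\<Sum>j\<in>D. (2::nat) ^ e (f ! j) j) = (\<Sum>x\<in>(\<lambda>j. e (f ! j) j) ` D. 2 ^ x)"
    using inj by (simp add: sum.reindex)
  also have "\<dots> \<le> (\<Sum>x<e (g ! i) i. 2 ^ x)"
    using below by (intro sum_mono2) auto
  also have "\<dots> < 2 ^ e (g ! i) i" by (simp add: lessThan_atLeast0 sum_power2)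
  also have "\<dots> \<le> (\<Sum>j\<in>D. 2 ^ e (g ! j) j)"
    using iD by (intro member_le_sum) (auto simp: D_def)
  finally have less: "(\<Sum>j\<in>D. (2::nat) ^ e (f ! j) j) < (\<Sum>j\<in>D. 2 ^ e (g ! j) j)" .
  have split: "(\<Sum>j<n. (2::nat) ^ e (x ! j) j) =
      (\<Sum>j\<in>{..<n} - D. 2 ^ e (x ! j) j) + (\<Sum>j\<in>D. 2 ^ e (x ! j) j)" for x
    by (rule sum.subset_diff) (auto simp: D_def)
  have "(\<Sum>j\<in>{..<n} - D. (2::nat) ^ e (f ! j) j) = (\<Sum>j\<in>{..<n} - D. 2 ^ e (g ! j) j)"
    by (rule sum.cong) (auto simp: D_def)
  with less have "(\<Sum>j<n. (2::nat) ^ e (f ! j) j) < (\<Sum>j<n. 2 ^ e (g ! j) j)"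
    unfolding split by simp
  then show ?thesis
    unfolding key_def n n_def[symmetric] by (simp add: e_def rank_def)
qed

lemma prec_asym: "prec f g \<Longrightarrow> \<not> prec g f"
  using prec_key_less[of "set f \<union> set g" f g] prec_key_less[of "set f \<union> set g" g f] by fastforce

lemma prec_irrefl: "\<not> prec f f"
  using prec_asym by blast

lemma prec_if_le:
  assumes "length f = length g" "f \<noteq> g" "\<And>k. k < length g \<Longrightarrow> f ! k \<le> g ! k"
  shows "prec f g"
proof -
  have "\<not> prec g f" unfolding prec_def using assms(1,3) by (metis not_le)
  then show ?thesis using prec_total assms by blast
qed

lemma ex_prec_enumeration:
  assumes "finite V" "finite L" "\<And>f. f \<in> L \<Longrightarrow> length f = n \<and> set f \<subseteq> V"
  obtains xs where "set xs = L"
    "\<And>p q. p < length xs \<Longrightarrow> q < length xs \<Longrightarrow> prec (xs ! p) (xs ! q) \<longleftrightarrow> p < q"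
proof -
  have prec_iff: "prec f g \<longleftrightarrow> key V f < key V g" if "f \<in> L" "g \<in> L" for f g
    using prec_key_less[OF assms(1), of f g] prec_key_less[OF assms(1), of g f]
      prec_total[of f g] prec_irrefl[of f] assms(3) that by fastforce
  have "inj_on (key V) L"
  proof (rule inj_onI)
    fix f g assume "f \<in> L" "g \<in> L" "key V f = key V g"
    then show "f = g" using prec_total[of f g] prec_iff assms(3) by (metis less_irrefl)
  qed
  from ex_enumeration[OF assms(2) this] obtain xs where xs: "set xs = L"
    "\<And>p q. p < q \<Longrightarrow> q < length xs \<Longrightarrow> key V (xs ! p) < key V (xs ! q)" by blast
  show thesis
  proof
    fix p q assume pq: "p < length xs" "q < length xs"
    then have "xs ! p \<in> L" "xs ! q \<in> L" using xs(1) nth_mem by blast+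
    then show "prec (xs ! p) (xs ! q) \<longleftrightarrow> p < q"
      using prec_iff[of "xs ! p" "xs ! q"] xs(2)[of p q] xs(2)[of q p] pq
      by (cases p q rule: linorder_cases) auto
  qed (rule xs(1))
qed

section \<open>Finite truncated monoids\<close>

text \<open>
  A finite set of values, closed under addition truncated at its largest element \<open>top\<close>. The last
  assumption is the archimedean property in the form in which it is used.
\<close>

locale truncated_monoid =
  fixes V :: "'m::distance_monoid set" and top :: 'm
  assumes finite_V: "finite V" and zero_V: "0 \<in> V" and top_V: "top \<in> V"
    and le_top: "v \<in> V \<Longrightarrow> v \<le> top"
    and closed: "v \<in> V \<Longrightarrow> w \<in> V \<Longrightarrow> min top (v + w) \<in> V"
    and gap: "v \<in> V \<Longrightarrow> r \<in> V \<Longrightarrow> v \<noteq> 0 \<Longrightarrow> r \<noteq> 0 \<Longrightarrow> \<exists>c\<in>V. c < v \<and> v \<le> c + r"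
begin

text \<open>
  A metric on \<open>{..<n}\<close> with distances in \<open>V\<close>; spaces with \<open>n\<close> points are represented on
  this set, so that the order of the points is that of the natural numbers.
\<close>

definition vmetric :: "nat \<Rightarrow> (nat \<Rightarrow> nat \<Rightarrow> 'm) \<Rightarrow> bool"
  where "vmetric n d \<longleftrightarrow> (\<forall>i<n. \<forall>j<n. d i j \<in> V \<and> (d i j = 0 \<longleftrightarrow> i = j) \<and> d i j = d j i \<and>
    (\<forall>k<n. d i k \<le> d i j + d j k))"

lemma vmetricD:
  assumes "vmetric n d" "i < n" "j < n"
  shows "d i j \<in> V" "d i j = 0 \<longleftrightarrow> i = j" "d i j = d j i" "k < n \<Longrightarrow> d i k \<le> d i j + d j k"
  using assms unfolding vmetric_def by blast+

text \<open>
  The functions \<open>f\<close> from \<open>{..<n}\<close> to \<open>V\<close> that are Lipschitz with constant one.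
\<close>

definition lip :: "nat \<Rightarrow> (nat \<Rightarrow> nat \<Rightarrow> 'm) \<Rightarrow> 'm list set"
  where "lip n d = {f. length f = n \<and> set f \<subseteq> V \<and> (\<forall>i<n. \<forall>j<n. f ! i \<le> f ! j + d i j)}"

lemma lipD:
  assumes "f \<in> lip n d"
  shows "length f = n" "set f \<subseteq> V" "i < n \<Longrightarrow> f ! i \<in> V"
    "i < n \<Longrightarrow> j < n \<Longrightarrow> f ! i \<le> f ! j + d i j"
  using assms by (auto simp: lip_def)

lemma finite_lip: "finite (lip n d)"
proof -
  have "lip n d \<subseteq> {f. set f \<subseteq> V \<and> length f = n}" by (auto simp: lip_def)
  then show ?thesis using finite_lists_length_eq[OF finite_V] finite_subset by blast
qed

lemma ex_lip_enumeration:
  obtains xs where "set xs = lip n d"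
    "\<And>p q. p < length xs \<Longrightarrow> q < length xs \<Longrightarrow> prec (xs ! p) (xs ! q) \<longleftrightarrow> p < q"
proof -
  have "length f = n \<and> set f \<subseteq> V" if "f \<in> lip n d" for f using lipD[OF that] by blast
  from ex_prec_enumeration[OF finite_V finite_lip this] show thesis using that by blast
qed

lemma zero_lip: "replicate n 0 \<in> lip n d"
  using zero_V zero_least by (auto simp: lip_def)

text \<open>
  The predecessor of \<open>v\<close> in \<open>V\<close>.
\<close>

definition pred_value :: "'m \<Rightarrow> 'm"
  where "pred_value v = Max {c \<in> V. c < v}"

lemma pred_value:
  assumes "v \<noteq> 0"
  shows "pred_value v \<in> V" "pred_value v < v" "\<And>c. c \<in> V \<Longrightarrow> c < v \<Longrightarrow> c \<le> pred_value v"
proof -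
  have "0 < v" using assms zero_least[of v] by simp
  then have "{c \<in> V. c < v} \<noteq> {}" using zero_V by auto
  then have "pred_value v \<in> {c \<in> V. c < v}"
    unfolding pred_value_def using finite_V by (intro Max_in) auto
  then show "pred_value v \<in> V" "pred_value v < v" by auto
  show "c \<le> pred_value v" if "c \<in> V" "c < v" for c
    using that finite_V by (simp add: pred_value_def)
qed

lemma le_pred_value_add:
  assumes "v \<noteq> 0" "x \<in> V" "x \<le> v" "r \<in> V" "r \<noteq> 0"
  shows "x \<le> pred_value v + r"
proof (cases "x = v")
  case True
  then obtain c where "c \<in> V" "c < v" "v \<le> c + r" using gap assms by blast
  moreover from this have "c + r \<le> pred_value v + r"
    using pred_value(3)[OF assms(1)] by (intro add_mono_both) auto
  ultimately show ?thesis using True by simp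
next
  case False
  then have "x \<le> pred_value v" using pred_value(3)[OF assms(1)] assms by simp
  then show ?thesis using le_add_left order_trans by blast
qed

end

text \<open>
  The truncated sums of elements of \<open>D\<close>. If \<open>r\<close> is the least nonzero element of \<open>D\<close> and
  \<open>top \<le> nmult n r\<close>, then sums of more than \<open>n\<close> nonzero elements are truncated to \<open>top\<close>.
\<close>

lemma ex_truncated_monoid:
  fixes D :: "'m::distance_monoid set"
  assumes D: "finite D"
    and arch: "\<And>r s :: 'm. r \<noteq> 0 \<Longrightarrow> s \<noteq> 0 \<Longrightarrow> \<exists>n>0. s \<le> nmult n r"
  obtains V top where "truncated_monoid V top" "D \<subseteq> V"
proof
  define E where "E = insert 0 D"
  define top where "top = Max E"
  have E: "finite E" "E \<noteq> {}" using D by (auto simp: E_def)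
  then have top: "top \<in> E" "\<And>e. e \<in> E \<Longrightarrow> e \<le> top" by (auto simp: top_def)
  define V where "V = {min top (sum_list l) | l. set l \<subseteq> D}"
  show "D \<subseteq> V"
  proof
    fix e assume "e \<in> D"
    then have "e = min top (sum_list [e])" using top(2) by (simp add: E_def min_absorb2)
    then show "e \<in> V" using \<open>e \<in> D\<close> unfolding V_def by (intro CollectI exI[of _ "[e]"]) auto
  qed
  have zero: "0 \<in> V"
    unfolding V_def using zero_least[of top] by (intro CollectI exI[of _ "[]"]) simp
  have le: "v \<le> top" if "v \<in> V" for v using that by (auto simp: V_def)
  have closed: "min top (v + w) \<in> V" if vw: "v \<in> V" "w \<in> V" for v w
  proof -
    from vw obtain l k where lk: "set l \<subseteq> D" "set k \<subseteq> D"
      "v = min top (sum_list l)" "w = min top (sum_list k)" by (auto simp: V_def)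
    have absorb: "min top (min top x + min top y) = min top (x + y)" for x y :: 'm
    proof -
      have "top \<le> x \<Longrightarrow> top \<le> x + y" "top \<le> y \<Longrightarrow> top \<le> x + y"
        using le_add_left[of x y] le_add_right[of y x] by (blast intro: order_trans)+
      then show ?thesis
        using le_add_left[of top "min top y"] le_add_left[of top y] le_add_right[of top x]
        by (auto simp: min_def)
    qed
    have "min top (v + w) = min top (sum_list (l @ k))"
      unfolding lk(3,4) absorb by simp
    then show ?thesis using lk(1,2) unfolding V_def by (intro CollectI exI[of _ "l @ k"]) simp
  qed
  have nmult_Suc: "nmult (Suc n) r = r + nmult n r" for n and r :: 'm
    by (simp add: nmult_def)
  show "truncated_monoid V top"
  proof
    show "finite V"
    proof (cases "D \<subseteq> {0}")
      case True
      have "sum_list l = 0" if "set l \<subseteq> D" for l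
        using that True by (induction l) auto
      then have "V \<subseteq> {min top 0}" by (auto simp: V_def)
      then show ?thesis by (rule finite_subset) simp
    next
      case False
      define r where "r = Min (D - {0})"
      have "r \<in> D - {0}" unfolding r_def using D False by (intro Min_in) auto
      moreover have r_le: "r \<le> e" if "e \<in> D" "e \<noteq> 0" for e
        unfolding r_def using D that by (intro Min_le) auto
      moreover have "top \<noteq> 0" using top(2)[of r] \<open>r \<in> D - {0}\<close> zero_least[of r] by (auto simp: E_def)
      ultimately obtain n where n: "top \<le> nmult n r" using arch[of r top] by auto
      have long: "nmult (length l) r \<le> sum_list l" if "set l \<subseteq> D - {0}" for l
        using that
      proof (induction l)
        case (Cons e l)
        then show ?case by (auto simp: nmult_Suc intro!: add_mono_both r_le)
      qed (simp add: nmult_def)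
      have mono: "nmult n r \<le> nmult (n + k) r" for k
      proof (induction k)
        case (Suc k)
        then show ?case using le_add_right order_trans by (simp add: nmult_Suc) blast
      qed simp
      have "V \<subseteq> insert top ((\<lambda>l. min top (sum_list l)) ` {l. set l \<subseteq> D \<and> length l \<le> n})"
      proof
        fix v assume "v \<in> V"
        then obtain l where l: "set l \<subseteq> D" "v = min top (sum_list l)" by (auto simp: V_def)
        define k where "k = filter (\<lambda>e. e \<noteq> 0) l"
        have sum: "sum_list l = sum_list k" unfolding k_def by (induction l) auto
        have k: "set k \<subseteq> D - {0}" using l(1) by (auto simp: k_def)
        show "v \<in> insert top ((\<lambda>l. min top (sum_list l)) ` {l. set l \<subseteq> D \<and> length l \<le> n})"
        proof (cases "length k \<le> n")
          case True
          then show ?thesis using k l(2) sum by auto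
        next
          case False
          then have "top \<le> nmult (length k) r"
            using n mono[of "length k - n"] by (simp add: order_trans)
          also have "\<dots> \<le> sum_list k" by (rule long[OF k])
          finally show ?thesis using l(2) sum by simp
        qed
      qed
      then show ?thesis by (rule finite_subset) (simp add: finite_lists_length_le[OF D])
    qed
  next
    show "top \<in> V" using top(1) zero \<open>D \<subseteq> V\<close> by (auto simp: E_def)
  next
    fix v r assume vr: "v \<in> V" "r \<in> V" "v \<noteq> 0" "r \<noteq> 0"
    (* The largest multiple of r below v is the element c required. *)
    obtain n where "v \<le> nmult n r" using arch vr by blast
    then have ex: "v \<le> nmult (LEAST n. v \<le> nmult n r) r" by (rule LeastI)
    define n where "n = (LEAST n. v \<le> nmult n r)"
    have n: "v \<le> nmult n r" using ex by (simp add: n_def)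
    have "n \<noteq> 0" using n vr(3) zero_least[of v] by (cases n) (auto simp: nmult_def)
    then obtain k where k: "n = Suc k" by (cases n) auto
    have less: "nmult k r < v"
      using not_less_Least[of k "\<lambda>n. v \<le> nmult n r"] k unfolding n_def by simp
    have "min top (nmult k r) \<in> V" for k
    proof (induction k)
      case 0
      then show ?case using zero zero_least[of top] by (simp add: nmult_def)
    next
      case (Suc k)
      have "min top (min top (nmult k r) + r) = min top (nmult k r + r)"
        using le_add_left[of top r] order_trans[OF _ le_add_left[of "nmult k r" r]]
        by (auto simp: min_def)
      also have "\<dots> = min top (nmult (Suc k) r)" by (simp add: nmult_Suc add.commute)
      finally have "min top (min top (nmult k r) + r) = min top (nmult (Suc k) r)" .
      then show ?case using closed[OF Suc vr(2)] by simp
    qed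
    then have "nmult k r \<in> V"
      using less le[OF vr(1)] by (metis less_le_trans less_imp_le min_absorb2)
    then show "\<exists>c\<in>V. c < v \<and> v \<le> c + r"
      using less n k by (intro bexI[of _ "nmult k r"]) (auto simp: nmult_Suc add.commute)
  qed (use zero le closed in auto)
qed

section \<open>Extension and restriction of Lipschitz functions\<close>

text \<open>
  An embedding \<open>h\<close> of the space \<open>d\<close> on \<open>{..<a}\<close> into the space \<open>d'\<close> on \<open>{..<b}\<close>.
\<close>

locale metric_embedding = truncated_monoid V top
  for V :: "'m::distance_monoid set" and top +
  fixes a b :: nat and d d' :: "nat \<Rightarrow> nat \<Rightarrow> 'm" and h :: "nat \<Rightarrow> nat"
  assumes target: "vmetric b d'" and h_less: "i < a \<Longrightarrow> h i < b"
    and h_order: "i < a \<Longrightarrow> j < a \<Longrightarrow> h i \<le> h j \<longleftrightarrow> i \<le> j"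
    and h_dist: "i < a \<Longrightarrow> j < a \<Longrightarrow> d' (h i) (h j) = d i j"
begin

definition restriction :: "'m list \<Rightarrow> 'm list"
  where "restriction g = map (\<lambda>i. g ! h i) [0..<a]"

text \<open>
  The values that an extension of \<open>f\<close> may take at \<open>k\<close> as far as the lower bounds imposed by
  \<open>f\<close> are concerned. The pointwise least choice turns out to be an extension, the least one.
\<close>

definition bounds :: "'m list \<Rightarrow> nat \<Rightarrow> 'm set"
  where "bounds f k = {c \<in> V. \<forall>i<a. f ! i \<le> c + d' (h i) k}"

definition extension :: "'m list \<Rightarrow> 'm list"
  where "extension f = map (\<lambda>k. Min (bounds f k)) [0..<b]"

lemma nth_restriction [simp]: "i < a \<Longrightarrow> restriction g ! i = g ! h i"
  by (simp add: restriction_def)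

lemma length_restriction [simp]: "length (restriction g) = a"
  by (simp add: restriction_def)

lemma length_extension [simp]: "length (extension f) = b"
  by (simp add: extension_def)

lemma restriction_lip:
  assumes "g \<in> lip b d'"
  shows "restriction g \<in> lip a d"
proof -
  have "restriction g ! i \<le> restriction g ! j + d i j" if "i < a" "j < a" for i j
    using lipD(4)[OF assms h_less[OF that(1)] h_less[OF that(2)]] h_dist[OF that] that by simp
  moreover have "set (restriction g) \<subseteq> V"
    using lipD(3)[OF assms] h_less by (auto simp: restriction_def)
  ultimately show ?thesis by (simp add: lip_def)
qed

lemma extension_nth:
  assumes "f \<in> lip a d" "k < b"
  shows "extension f ! k \<in> bounds f k" "\<And>c. c \<in> bounds f k \<Longrightarrow> extension f ! k \<le> c"
proof -
  have "f ! i \<le> top + d' (h i) k" if "i < a" for i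
    using le_top[OF lipD(3)[OF assms(1) that]] le_add_left order_trans by blast
  then have "top \<in> bounds f k" using top_V by (simp add: bounds_def)
  moreover have fin: "finite (bounds f k)" using finite_V by (simp add: bounds_def)
  ultimately have "Min (bounds f k) \<in> bounds f k" by (intro Min_in) auto
  then show "extension f ! k \<in> bounds f k" using assms by (simp add: extension_def)
  show "extension f ! k \<le> c" if "c \<in> bounds f k" for c
    using fin that assms by (simp add: extension_def)
qed

lemma extension_least:
  assumes "f \<in> lip a d" "g \<in> lip b d'" "restriction g = f" "k < b"
  shows "extension f ! k \<le> g ! k"
proof -
  have "f ! i \<le> g ! k + d' (h i) k" if "i < a" for i
    using lipD(4)[OF assms(2) h_less[OF that] assms(4)] assms(3) that by auto
  then show ?thesis
    using extension_nth(2)[OF assms(1,4)] lipD(3)[OF assms(2,4)] by (simp add: bounds_def)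
qed

lemma extension_h:
  assumes "f \<in> lip a d" "j < a"
  shows "extension f ! h j = f ! j"
proof (rule antisym)
  have "f ! j \<in> bounds f (h j)"
    using lipD(3,4)[OF assms(1)] assms(2) h_dist by (simp add: bounds_def)
  then show "extension f ! h j \<le> f ! j" using extension_nth(2)[OF assms(1) h_less] assms by blast
  have "d' (h j) (h j) = 0" using vmetricD(2)[OF target] h_less assms by blast
  then show "f ! j \<le> extension f ! h j"
    using extension_nth(1)[OF assms(1) h_less[OF assms(2)]] assms(2) by (force simp: bounds_def)
qed

lemma restriction_extension: "f \<in> lip a d \<Longrightarrow> restriction (extension f) = f"
  by (intro nth_equalityI) (auto simp: extension_h dest: lipD(1))

lemma extension_lip:
  assumes "f \<in> lip a d"
  shows "extension f \<in> lip b d'"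
proof -
  have V: "extension f ! k \<in> V" if "k < b" for k
    using extension_nth(1)[OF assms that] by (simp add: bounds_def)
  have "extension f ! k \<le> extension f ! l + d' k l" if kl: "k < b" "l < b" for k l
  proof -
    define c where "c = min top (extension f ! l + d' k l)"
    have "f ! i \<le> c + d' (h i) k" if i: "i < a" for i
    proof -
      have "f ! i \<le> extension f ! l + d' (h i) l"
        using extension_nth(1)[OF assms kl(2)] i by (simp add: bounds_def)
      also have "\<dots> \<le> extension f ! l + (d' (h i) k + d' k l)"
        using vmetricD(4)[OF target h_less[OF i] kl] by (intro add_mono_both) auto
      finally have "f ! i \<le> (extension f ! l + d' k l) + d' (h i) k" by (simp add: ac_simps)
      moreover have "f ! i \<le> top + d' (h i) k"
        using le_top[OF lipD(3)[OF assms i]] le_add_left order_trans by blast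
      ultimately show ?thesis by (simp add: c_def min_def)
    qed
    moreover have "c \<in> V" unfolding c_def by (intro closed V vmetricD(1)[OF target] kl)
    ultimately have "c \<in> bounds f k" by (simp add: bounds_def)
    then have "extension f ! k \<le> c" by (rule extension_nth(2)[OF assms kl(1)])
    then show ?thesis by (simp add: c_def)
  qed
  then show ?thesis using V by (auto simp: lip_def in_set_conv_nth)
qed

text \<open>
  The effect of the archimedean property: outside the image of \<open>h\<close>, two least extensions can
  differ only below the level \<open>v\<close> up to which the given functions differ. For arguments with
  \<open>f ! j \<le> v\<close> the predecessor of \<open>v\<close> already satisfies the bound at \<open>k\<close>.
\<close>

lemma extension_less:
  assumes f: "f \<in> lip a d" and f': "f' \<in> lip a d" and v: "v \<noteq> 0"
    and differ: "\<And>j. j < a \<Longrightarrow> f ! j \<noteq> f' ! j \<Longrightarrow> f ! j \<le> v"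
    and k: "k < b" "k \<notin> h ` {..<a}" and less: "extension f' ! k < extension f ! k"
  shows "extension f ! k < v"
proof -
  define c where "c = extension f' ! k"
  have c: "c \<in> V" "\<And>i. i < a \<Longrightarrow> f' ! i \<le> c + d' (h i) k"
    using extension_nth(1)[OF f' k(1)] by (auto simp: c_def bounds_def)
  have "c \<notin> bounds f k" using extension_nth(2)[OF f k(1)] less by (force simp: c_def)
  then obtain i where i: "i < a" "c + d' (h i) k < f ! i"
    using c(1) by (auto simp: bounds_def not_le)
  then have "f ! i \<noteq> f' ! i" using c(2)[OF i(1)] by auto
  then have "c < v"
    using i(2) differ[OF i(1)] le_add_left[of c "d' (h i) k"] by (meson le_less_trans less_le_trans)
  have "pred_value v \<in> bounds f k"
  proof -
    have "f ! j \<le> pred_value v + d' (h j) k" if j: "j < a" for j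
    proof (cases "f ! j = f' ! j")
      case True
      have "c + d' (h j) k \<le> pred_value v + d' (h j) k"
        using pred_value(3)[OF v c(1) \<open>c < v\<close>] by (intro add_mono_both) auto
      then show ?thesis using True c(2)[OF j] by simp
    next
      case False
      have "d' (h j) k \<noteq> 0" using vmetricD(2)[OF target h_less[OF j] k(1)] k(2) j by auto
      then show ?thesis
        using le_pred_value_add[OF v lipD(3)[OF f j] differ[OF j False]]
          vmetricD(1)[OF target h_less[OF j] k(1)] by blast
    qed
    then show ?thesis using pred_value(1)[OF v] by (simp add: bounds_def)
  qed
  then have "extension f ! k \<le> pred_value v" by (rule extension_nth(2)[OF f k(1)])
  also have "\<dots> < v" by (rule pred_value(2)[OF v])
  finally show ?thesis .
qed

lemma extension_prec:
  assumes f: "f \<in> lip a d" and f': "f' \<in> lip a d" and prec: "prec f f'"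
  shows "prec (extension f) (extension f')"
proof -
  have len: "length f' = a" using lipD(1)[OF f'] .
  from prec obtain i where i: "i < a" "f ! i < f' ! i"
    and max: "\<And>j. j < a \<Longrightarrow> f ! j \<noteq> f' ! j \<Longrightarrow>
      f ! j < f' ! i \<and> f' ! j < f' ! i \<or> f ! j \<le> f' ! i \<and> f' ! j \<le> f' ! i \<and> i \<le> j"
    unfolding prec_def len by blast
  have v: "f' ! i \<noteq> 0" using i(2) zero_least[of "f ! i"] by auto
  have "extension f ! k < f' ! i \<and> extension f' ! k < f' ! i \<or>
      extension f ! k \<le> f' ! i \<and> extension f' ! k \<le> f' ! i \<and> h i \<le> k"
    if k: "k < b" "extension f ! k \<noteq> extension f' ! k" for k
  proof (cases "k \<in> h ` {..<a}")
    case True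
    then obtain j where j: "j < a" "k = h j" by auto
    then show ?thesis
      using max[of j] k(2) h_order[OF i(1) j(1)] extension_h[OF f j(1)] extension_h[OF f' j(1)] by simp
  next
    case False
    have 1: "extension f' ! k < extension f ! k \<Longrightarrow> extension f ! k < f' ! i"
      by (rule extension_less[OF f f' v _ k(1) False]) (use max in fastforce)
    have 2: "extension f ! k < extension f' ! k \<Longrightarrow> extension f' ! k < f' ! i"
      by (rule extension_less[OF f' f v _ k(1) False]) (use max in fastforce)
    show ?thesis using 1 2 k(2) by (meson less_trans linorder_neqE)
  qed
  then show ?thesis unfolding prec_def
    using i extension_h[OF f i(1)] extension_h[OF f' i(1)] h_less[OF i(1)]
    by (intro conjI exI[of _ "h i"]) auto
qed

text \<open>
  When the functions on both spaces are listed in increasing order, the restriction map becomes a rigid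
  word \<open>w\<close>: its first letter equal to the index of \<open>f\<close> is at the index of the least extension of
  \<open>f\<close>.
\<close>

lemma restriction_rigid:
  assumes xs: "set xs = lip a d"
    "\<And>p q. p < length xs \<Longrightarrow> q < length xs \<Longrightarrow> prec (xs ! p) (xs ! q) \<longleftrightarrow> p < q"
    and ys: "set ys = lip b d'"
    "\<And>p q. p < length ys \<Longrightarrow> q < length ys \<Longrightarrow> prec (ys ! p) (ys ! q) \<longleftrightarrow> p < q"
  obtains w where "length w = length ys" "rigid 0 (length xs) w"
    "\<And>p. p < length ys \<Longrightarrow> xs ! (w ! p) = restriction (ys ! p)"
proof -
  have "\<exists>k<length xs. xs ! k = restriction (ys ! p)" if "p < length ys" for p
    using restriction_lip[of "ys ! p"] that xs(1) ys(1) nth_mem by (metis in_set_conv_nth)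
  then obtain F where F: "\<And>p. p < length ys \<Longrightarrow> F p < length xs \<and> xs ! F p = restriction (ys ! p)"
    by metis
  define w where "w = map F [0..<length ys]"
  have wp: "w ! p = F p" if "p < length ys" for p using that by (simp add: w_def)
  have inj: "p = q" if "p < length xs" "q < length xs" "xs ! p = xs ! q" for p q
    using xs(2)[of p q] xs(2)[of q p] that prec_irrefl by (metis linorder_neqE_nat)
  have ext: "\<exists>q<length ys. ys ! q = extension (xs ! k) \<and> F q = k" if k: "k < length xs" for k
  proof -
    have f: "xs ! k \<in> lip a d" using k xs(1) nth_mem by blast
    then obtain q where q: "q < length ys" "ys ! q = extension (xs ! k)"
      using extension_lip ys(1) by (metis in_set_conv_nth)
    then have "xs ! F q = xs ! k" using F restriction_extension[OF f] by simp
    then have "F q = k" using inj F q(1) k by blast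
    then show ?thesis using q by blast
  qed
  have "rigid 0 (length xs) w"
  proof (rule rigidI)
    show "set w \<subseteq> {..<length xs}" using F by (auto simp: w_def)
    show "{0..<length xs} \<subseteq> set w"
    proof
      fix k assume "k \<in> {0..<length xs}"
      then obtain q where "q < length ys" "F q = k" using ext[of k] by auto
      then show "k \<in> set w" by (auto simp: w_def)
    qed
  next
    fix p i assume p: "p < length w" and i: "i < w ! p"
    then have p: "p < length ys" by (simp add: w_def)
    have k: "F p < length xs" "i < F p" using F[OF p] i wp[OF p] by auto
    obtain q where q: "q < length ys" "ys ! q = extension (xs ! i)" "F q = i"
      using ext[of i] k by auto
    obtain q' where q': "q' < length ys" "ys ! q' = extension (xs ! F p)"
      using ext[of "F p"] k by auto
    have lip: "xs ! i \<in> lip a d" "xs ! F p \<in> lip a d" "ys ! p \<in> lip b d'"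
      using k p xs(1) ys(1) nth_mem by (metis less_trans)+
    have "q < q'"
      using extension_prec[OF lip(1,2)] xs(2)[of i "F p"] ys(2)[of q q'] k q q' by simp
    moreover have "q' \<le> p"
    proof (cases "extension (xs ! F p) = ys ! p")
      case True
      then show ?thesis using ys(2)[OF p q'(1)] q'(2) prec_irrefl by (metis not_le)
    next
      case False
      then have "prec (ys ! q') (ys ! p)"
        unfolding q'(2) using lipD(1)[OF lip(3)] extension_least[OF lip(2,3)] F[OF p]
        by (intro prec_if_le) auto
      then show ?thesis using ys(2)[OF q'(1) p] by simp
    qed
    ultimately show "\<exists>q<p. w ! q = i" using q wp by (intro exI[of _ q]) simp
  qed simp
  then show thesis using F wp by (intro that[of w]) (auto simp: w_def)
qed

end

section \<open>Spaces of words\<close>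

context truncated_monoid
begin

text \<open>
  The metric on \<open>V\<close> that replaces the absolute difference of numbers.
\<close>

definition diff :: "'m \<Rightarrow> 'm \<Rightarrow> 'm"
  where "diff x y = Min {c \<in> V. x \<le> y + c \<and> y \<le> x + c}"

lemma diff:
  assumes "x \<in> V" "y \<in> V"
  shows "diff x y \<in> V" "x \<le> y + diff x y" "y \<le> x + diff x y"
    "\<And>c. c \<in> V \<Longrightarrow> x \<le> y + c \<Longrightarrow> y \<le> x + c \<Longrightarrow> diff x y \<le> c"
proof -
  have "top \<in> {c \<in> V. x \<le> y + c \<and> y \<le> x + c}"
    using top_V le_top[OF assms(1)] le_top[OF assms(2)] le_add_right order_trans by blast
  moreover have fin: "finite {c \<in> V. x \<le> y + c \<and> y \<le> x + c}" using finite_V by simp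
  ultimately have "diff x y \<in> {c \<in> V. x \<le> y + c \<and> y \<le> x + c}"
    unfolding diff_def by (intro Min_in) auto
  then show "diff x y \<in> V" "x \<le> y + diff x y" "y \<le> x + diff x y" by auto
  show "diff x y \<le> c" if "c \<in> V" "x \<le> y + c" "y \<le> x + c" for c
    unfolding diff_def using fin that by (intro Min_le) auto
qed

lemma diff_commute: "diff x y = diff y x"
  unfolding diff_def by (rule arg_cong[where f = Min]) auto

lemma diff_eq_0: "x \<in> V \<Longrightarrow> y \<in> V \<Longrightarrow> diff x y = 0 \<longleftrightarrow> x = y"
  using diff[of x y] zero_V zero_least[of "diff x y"] by (auto intro: antisym)

lemma diff_triangle:
  assumes "x \<in> V" "y \<in> V" "z \<in> V"
  shows "diff x z \<le> diff x y + diff y z"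
proof -
  define c where "c = min top (diff x y + diff y z)"
  have c: "c \<in> V" unfolding c_def by (intro closed diff(1) assms)
  have "x \<le> z + (diff x y + diff y z)"
  proof -
    have "x \<le> y + diff x y" by (rule diff(2)) fact+
    also have "\<dots> \<le> (z + diff y z) + diff x y"
      using diff(2)[OF assms(2,3)] by (intro add_mono_both) auto
    finally show ?thesis by (simp add: ac_simps)
  qed
  moreover have "x \<le> z + top" using le_top[OF assms(1)] le_add_right order_trans by blast
  ultimately have 1: "x \<le> z + c" by (simp add: c_def min_def)
  have "z \<le> x + (diff x y + diff y z)"
  proof -
    have "z \<le> y + diff y z" by (rule diff(3)) fact+
    also have "\<dots> \<le> (x + diff x y) + diff y z"
      using diff(3)[OF assms(1,2)] by (intro add_mono_both) auto
    finally show ?thesis by (simp add: ac_simps)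
  qed
  moreover have "z \<le> x + top" using le_top[OF assms(3)] le_add_right order_trans by blast
  ultimately have 2: "z \<le> x + c" by (simp add: c_def min_def)
  have "diff x z \<le> c" by (rule diff(4)[OF assms(1,3) c 1 2])
  then show ?thesis by (simp add: c_def)
qed

text \<open>
  The maximum metric. The additional \<open>0\<close> gives the empty words distance \<open>0\<close>.
\<close>

definition word_dist :: "'m list \<Rightarrow> 'm list \<Rightarrow> 'm"
  where "word_dist x y = Max (insert 0 ((\<lambda>p. diff (x ! p) (y ! p)) ` {..<length x}))"

definition words :: "nat \<Rightarrow> 'm list set"
  where "words n = {x. set x \<subseteq> V \<and> length x = n}"

lemma wordsD: "x \<in> words n \<Longrightarrow> length x = n" "x \<in> words n \<Longrightarrow> p < n \<Longrightarrow> x ! p \<in> V"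
  by (auto simp: words_def)

lemma finite_words: "finite (words n)"
  unfolding words_def by (rule finite_lists_length_eq[OF finite_V])

lemma diff_le_word_dist: "p < length x \<Longrightarrow> diff (x ! p) (y ! p) \<le> word_dist x y"
  unfolding word_dist_def by (intro Max_ge) auto

lemma word_dist_le: "(\<And>p. p < length x \<Longrightarrow> diff (x ! p) (y ! p) \<le> c) \<Longrightarrow> word_dist x y \<le> c"
  unfolding word_dist_def using zero_least[of c] by (subst Max_le_iff) auto

lemma word_dist_eq_0:
  assumes "x \<in> words n" "y \<in> words n"
  shows "word_dist x y = 0 \<longleftrightarrow> x = y"
proof
  assume eq: "word_dist x y = 0"
  show "x = y"
  proof (rule nth_equalityI)
    fix p assume p: "p < length x"
    then have "diff (x ! p) (y ! p) = 0"
      using diff_le_word_dist[OF p, of y] eq zero_least[of "diff (x ! p) (y ! p)"] by simp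
    then show "x ! p = y ! p" using diff_eq_0 assms p wordsD by metis
  qed (use assms wordsD(1) in metis)
next
  assume "x = y"
  then have "word_dist x y \<le> 0"
    using assms wordsD diff_eq_0 by (intro word_dist_le) (metis order_refl)
  then show "word_dist x y = 0" using zero_least[of "word_dist x y"] by simp
qed

lemma word_dist_commute:
  assumes "x \<in> words n" "y \<in> words n"
  shows "word_dist x y = word_dist y x"
proof -
  have "length x = length y" using assms wordsD(1) by metis
  then show ?thesis by (simp add: word_dist_def diff_commute)
qed

lemma word_dist_triangle:
  assumes "x \<in> words n" "y \<in> words n" "z \<in> words n"
  shows "word_dist x z \<le> word_dist x y + word_dist y z"
proof (rule word_dist_le)
  fix p assume p: "p < length x"
  then have "p < n" "p < length y" using wordsD(1) assms by auto
  then have "diff (x ! p) (z ! p) \<le> diff (x ! p) (y ! p) + diff (y ! p) (z ! p)"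
    using assms wordsD(2) by (intro diff_triangle)
  also have "\<dots> \<le> word_dist x y + word_dist y z"
    using p \<open>p < length y\<close> by (intro add_mono_both diff_le_word_dist)
  finally show "diff (x ! p) (z ! p) \<le> word_dist x y + word_dist y z" .
qed

text \<open>
  The words of length \<open>n\<close> over \<open>V\<close> as an ordered metric space, with the lexicographic order and
  with vertices named by an injection \<open>\<iota>\<close>.
\<close>

definition word_space :: "nat \<Rightarrow> ('m list \<Rightarrow> 'v) \<Rightarrow> ('v, 'm) ordered_space"
  where "word_space n \<iota> = \<lparr>verts = \<iota> ` words n,
    distance = restrict (\<lambda>(p, q). word_dist (inv_into (words n) \<iota> p) (inv_into (words n) \<iota> q))
      (\<iota> ` words n \<times> \<iota> ` words n),
    order_rel = {(\<iota> x, \<iota> y) | x y. x \<in> words n \<and> y \<in> words n \<and> x \<le> y}\<rparr>"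

lemma word_space_distance:
  "inj_on \<iota> (words n) \<Longrightarrow> x \<in> words n \<Longrightarrow> y \<in> words n \<Longrightarrow>
    distance (word_space n \<iota>) (\<iota> x, \<iota> y) = word_dist x y"
  by (simp add: word_space_def)

lemma word_space_order:
  assumes "inj_on \<iota> (words n)" "x \<in> words n" "y \<in> words n"
  shows "(\<iota> x, \<iota> y) \<in> order_rel (word_space n \<iota>) \<longleftrightarrow> x \<le> y"
  using assms by (auto simp: word_space_def dest: inj_onD)

lemma word_space_in_class:
  assumes inj: "inj_on \<iota> (words n)"
  shows "word_space n \<iota> \<in> ordered_metric_spaces"
proof -
  let ?C = "word_space n \<iota>"
  have verts: "verts ?C = \<iota> ` words n" by (simp add: word_space_def)
  have "monoid_metric (verts ?C) (distance ?C)"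
    unfolding monoid_metric_def verts
    using inj word_dist_eq_0 word_dist_commute word_dist_triangle
    by (auto simp: word_space_distance inj_on_eq_iff)
  moreover have "linear_order_on (verts ?C) (order_rel ?C)"
  proof -
    have "order_rel ?C \<subseteq> verts ?C \<times> verts ?C" by (auto simp: word_space_def)
    moreover have "refl_on (verts ?C) (order_rel ?C)"
      unfolding refl_on_def verts using word_space_order[OF inj] by (auto simp: word_space_def)
    moreover have "trans (order_rel ?C)"
    proof (rule transI)
      fix p q r assume pq: "(p, q) \<in> order_rel ?C" and qr: "(q, r) \<in> order_rel ?C"
      from pq obtain x y where xy: "p = \<iota> x" "q = \<iota> y" "x \<in> words n" "y \<in> words n" "x \<le> y"
        by (auto simp: word_space_def)
      from qr obtain y' z where z: "q = \<iota> y'" "r = \<iota> z" "y' \<in> words n" "z \<in> words n" "y' \<le> z"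
        by (auto simp: word_space_def)
      have "y = y'" using inj xy z by (auto dest: inj_onD)
      then show "(p, r) \<in> order_rel ?C"
        using xy z word_space_order[OF inj xy(3) z(4)] by auto
    qed
    moreover have "antisym (order_rel ?C)"
    proof (rule antisymI)
      fix p q assume pq: "(p, q) \<in> order_rel ?C" and qp: "(q, p) \<in> order_rel ?C"
      from pq obtain x y where xy: "p = \<iota> x" "q = \<iota> y" "x \<in> words n" "y \<in> words n" "x \<le> y"
        by (auto simp: word_space_def)
      have "y \<le> x" using qp xy word_space_order[OF inj xy(4,3)] by simp
      then show "p = q" using xy by simp
    qed
    moreover have "total_on (verts ?C) (order_rel ?C)"
    proof (rule total_onI)
      fix p q assume "p \<in> verts ?C" "q \<in> verts ?C"
      then obtain x y where xy: "p = \<iota> x" "q = \<iota> y" "x \<in> words n" "y \<in> words n"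
        by (auto simp: verts)
      show "(p, q) \<in> order_rel ?C \<or> (q, p) \<in> order_rel ?C"
        unfolding xy(1,2) word_space_order[OF inj xy(3,4)] word_space_order[OF inj xy(4,3)]
        by (rule linear)
    qed
    ultimately show ?thesis
      by (auto simp: linear_order_on_def partial_order_on_def preorder_on_def)
  qed
  ultimately show ?thesis
    using finite_words[of n]
    by (auto simp: ordered_metric_spaces_def verts) (auto simp: word_space_def)
qed

text \<open>
  The word representing the point \<open>i\<close>: its letters are the values at \<open>i\<close> of the functions in the
  list \<open>xs\<close>, taken in the order prescribed by \<open>u\<close>.
\<close>

definition point :: "'m list list \<Rightarrow> nat list \<Rightarrow> nat \<Rightarrow> 'm list"
  where "point xs u i = map (\<lambda>k. xs ! k ! i) u"

lemma length_point [simp]: "length (point xs u i) = length u"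
  by (simp add: point_def)

lemma nth_point [simp]: "p < length u \<Longrightarrow> point xs u i ! p = xs ! (u ! p) ! i"
  by (simp add: point_def)

lemma point_words:
  assumes "set xs = lip a d" "rigid 0 (length xs) u" "i < a"
  shows "point xs u i \<in> words (length u)"
proof -
  have "xs ! k ! i \<in> V" if "k \<in> set u" for k
  proof -
    have "xs ! k \<in> lip a d" using assms(1) rigid_set[OF assms(2)] that by (force simp flip: assms(1))
    then show ?thesis using lipD(3) assms(3) by blast
  qed
  then show ?thesis by (auto simp: words_def point_def)
qed

lemma point_dist:
  assumes d: "vmetric a d" and xs: "set xs = lip a d" and u: "rigid 0 (length xs) u"
    and ij: "i < a" "j < a"
  shows "word_dist (point xs u i) (point xs u j) = d i j"
proof (rule antisym)
  show "word_dist (point xs u i) (point xs u j) \<le> d i j"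
  proof (rule word_dist_le)
    fix p assume "p < length (point xs u i)"
    then have p: "p < length u" by simp
    then have "u ! p < length xs" using rigid_set[OF u] nth_mem by blast
    then have f: "xs ! (u ! p) \<in> lip a d" using xs nth_mem by blast
    have "diff (xs ! (u ! p) ! i) (xs ! (u ! p) ! j) \<le> d i j"
      using lipD(4)[OF f ij] lipD(4)[OF f ij(2,1)] lipD(3)[OF f] vmetricD(1,3)[OF d ij] ij
      by (intro diff(4)) auto
    then show "diff (point xs u i ! p) (point xs u j ! p) \<le> d i j" using p by simp
  qed
next
  define f where "f = map (d i) [0..<a]"
  have "f \<in> lip a d"
  proof -
    have "d i k \<le> d i l + d k l" if "k < a" "l < a" for k l
      using vmetricD(4)[OF d ij(1) that(2,1)] vmetricD(3)[OF d that] by simp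
    then show ?thesis using vmetricD(1)[OF d ij(1)] by (auto simp: lip_def f_def)
  qed
  then obtain k where k: "k < length xs" "xs ! k = f" using xs by (metis in_set_conv_nth)
  then obtain p where p: "p < length u" "u ! p = k"
    using rigid_set[OF u] by (metis atLeastLessThan_iff in_set_conv_nth le0 subsetD)
  have zero: "d i i = 0" using vmetricD(2)[OF d ij(1) ij(1)] by simp
  have "d i j \<le> diff 0 (d i j)"
    using diff(3)[OF zero_V vmetricD(1)[OF d ij]] by simp
  also have "\<dots> = diff (point xs u i ! p) (point xs u j ! p)"
    using p k ij zero by (simp add: f_def)
  also have "\<dots> \<le> word_dist (point xs u i) (point xs u j)"
    using p by (intro diff_le_word_dist) simp
  finally show "d i j \<le> word_dist (point xs u i) (point xs u j)" .
qed

text \<open>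
  The words of \<open>i < j\<close> first differ at the first occurrence of the least function \<open>f\<close> with
  \<open>f ! i \<noteq> f ! j\<close>. If \<open>f ! i\<close> were the larger value, then \<open>f\<close> would be preceded by the function
  \<open>g\<close> whose only nonzero value, the least nonzero element \<open>r\<close> of \<open>V\<close>, is at \<open>j\<close>; but
  \<open>g\<close> separates \<open>i\<close> and \<open>j\<close> as well.
\<close>

lemma point_less:
  assumes d: "vmetric a d" and xs: "set xs = lip a d"
    "\<And>p q. p < length xs \<Longrightarrow> q < length xs \<Longrightarrow> prec (xs ! p) (xs ! q) \<longleftrightarrow> p < q"
    and u: "rigid 0 (length xs) u" and ij: "i < j" "j < a"
  shows "point xs u i < point xs u j"
proof -
  have i: "i < a" using ij by simp
  have "d i j \<noteq> 0" using vmetricD(2)[OF d i ij(2)] ij(1) by simp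
  then have ne: "point xs u i \<noteq> point xs u j"
    using point_dist[OF d xs(1) u i ij(2)] word_dist_eq_0 point_words[OF xs(1) u] i ij(2) by metis
  define P where "P p \<longleftrightarrow> p < length u \<and> xs ! (u ! p) ! i \<noteq> xs ! (u ! p) ! j" for p
  have "\<exists>p. P p" using ne by (auto simp: P_def list_eq_iff_nth_eq)
  then have p: "P (LEAST p. P p)" by (rule LeastI_ex)
  define p where "p = (LEAST p. P p)"
  have least: "\<not> P q" if "q < p" for q using that not_less_Least unfolding p_def by blast
  have p: "p < length u" "xs ! (u ! p) ! i \<noteq> xs ! (u ! p) ! j"
    using p unfolding P_def p_def by blast+
  define f where "f = xs ! (u ! p)"
  have up: "u ! p < length xs" using rigid_set[OF u] p(1) nth_mem by blast
  then have f: "f \<in> lip a d" using xs(1) nth_mem unfolding f_def by blast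
  have "f ! i < f ! j"
  proof (rule ccontr)
    assume "\<not> f ! i < f ! j"
    then have fij: "f ! j < f ! i" using p(2) by (simp add: f_def)
    define r where "r = Min (V - {0})"
    have pos: "d i j \<in> V - {0}" using \<open>d i j \<noteq> 0\<close> vmetricD(1)[OF d i ij(2)] by simp
    have r: "r \<in> V" "r \<noteq> 0" "\<And>v. v \<in> V \<Longrightarrow> v \<noteq> 0 \<Longrightarrow> r \<le> v"
    proof -
      have "r \<in> V - {0}" unfolding r_def using finite_V pos by (intro Min_in) auto
      then show "r \<in> V" "r \<noteq> 0" by auto
      show "r \<le> v" if "v \<in> V" "v \<noteq> 0" for v
        unfolding r_def using finite_V that by (intro Min_le) auto
    qed
    define g where "g = map (\<lambda>k. if k = j then r else 0) [0..<a]"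
    have g: "g \<in> lip a d"
    proof -
      have "(if k = j then r else 0) \<le> (if l = j then r else 0) + d k l" if kl: "k < a" "l < a" for k l
      proof (cases "k = j \<and> l \<noteq> j")
        case True
        then have "r \<le> d k l" using r(3) vmetricD(1,2)[OF d kl] by auto
        then show ?thesis using True by simp
      next
        case False
        then show ?thesis using zero_least le_add_left by auto
      qed
      then show ?thesis using r zero_V by (auto simp: lip_def g_def)
    qed
    have gf: "g ! i = 0" "g ! j = r" "length g = a" using i ij by (auto simp: g_def)
    have fi: "r \<le> f ! i" using r(3)[OF lipD(3)[OF f i]] fij zero_least[of "f ! j"] by force
    have "\<not> prec f g"
    proof
      assume "prec f g"
      then obtain k where k: "k < a" "f ! k < g ! k" and max: "\<And>l. l < a \<Longrightarrow> f ! l \<noteq> g ! l \<Longrightarrow>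
          f ! l < g ! k \<and> g ! l < g ! k \<or> f ! l \<le> g ! k \<and> g ! l \<le> g ! k \<and> k \<le> l"
        unfolding prec_def gf by blast
      have "k = j"
      proof (rule ccontr)
        assume "k \<noteq> j"
        then have "g ! k = 0" using k(1) by (simp add: g_def)
        then show False using k(2) zero_least[of "f ! k"] by simp
      qed
      moreover have "f ! i \<noteq> g ! i" using gf(1) fij zero_least[of "f ! j"] by auto
      ultimately show False using max[OF i] fi ij(1) gf(2) by auto
    qed
    moreover have "g \<noteq> f" using gf fij zero_least[of "f ! j"] by auto
    ultimately have gf_prec: "prec g f" using prec_total lipD(1)[OF f] gf(3) by metis
    obtain k where k: "k < length xs" "xs ! k = g" using g xs(1) by (metis in_set_conv_nth)
    then have "k < u ! p" using gf_prec xs(2)[OF k(1) up] by (simp add: f_def)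
    then obtain q where "q < p" "u ! q = k" using rigid_first_occurrence[OF u p(1)] by blast
    then have "P q" using k p(1) gf r(2) by (simp add: P_def)
    then show False using least[OF \<open>q < p\<close>] by blast
  qed
  moreover have "take p (point xs u i) = take p (point xs u j)"
  proof (rule nth_take_lemma)
    fix q show "q < p \<longrightarrow> point xs u i ! q = point xs u j ! q"
      using least[of q] p(1) by (simp add: P_def)
  qed (use p(1) in auto)
  ultimately show ?thesis
    unfolding list_less_def lexord_take_index_conv
    using p(1) by (intro disjI2 exI[of _ p]) (simp add: f_def)
qed

end

section \<open>Copies of spaces and the Ramsey property\<close>

lemma ex_indexing:
  assumes "A \<in> ordered_metric_spaces"
  obtains g :: "nat \<Rightarrow> 'v" and a where "bij_betw g {..<a} (verts A)"
    "\<And>i j. i < a \<Longrightarrow> j < a \<Longrightarrow> (g i, g j) \<in> order_rel A \<longleftrightarrow> i \<le> j"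
proof -
  let ?S = "verts A" and ?r = "order_rel A"
  have fin: "finite ?S" and lin: "linear_order_on ?S ?r"
    using assms by (auto simp: ordered_metric_spaces_def)
  have refl: "refl_on ?S ?r" and trans: "trans ?r" and antisym: "antisym ?r" and total: "total_on ?S ?r"
    using lin by (auto simp: linear_order_on_def partial_order_on_def preorder_on_def)
  define key where "key x = card {y \<in> ?S. (y, x) \<in> ?r}" for x
  have key: "key x < key y" if "x \<in> ?S" "y \<in> ?S" "(x, y) \<in> ?r" "x \<noteq> y" for x y
  proof -
    have "y \<in> {z \<in> ?S. (z, y) \<in> ?r}" using that refl by (auto dest: refl_onD)
    moreover have "y \<notin> {z \<in> ?S. (z, x) \<in> ?r}" using that antisym by (auto dest: antisymD)
    moreover have "{z \<in> ?S. (z, x) \<in> ?r} \<subseteq> {z \<in> ?S. (z, y) \<in> ?r}"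
      using that trans by (auto dest: transD)
    ultimately show ?thesis unfolding key_def using fin by (intro psubset_card_mono) auto
  qed
  have tot: "(x, y) \<in> ?r \<or> (y, x) \<in> ?r" if "x \<in> ?S" "y \<in> ?S" "x \<noteq> y" for x y
    using total that by (auto simp: total_on_def)
  have "inj_on key ?S"
  proof (rule inj_onI, rule ccontr)
    fix x y assume xy: "x \<in> ?S" "y \<in> ?S" "key x = key y" "x \<noteq> y"
    then show False using tot[OF xy(1,2,4)] key[OF xy(1,2)] key[OF xy(2,1)] by auto
  qed
  from ex_enumeration[OF fin this] obtain xs where xs: "set xs = ?S"
    "\<And>p q. p < q \<Longrightarrow> q < length xs \<Longrightarrow> key (xs ! p) < key (xs ! q)" by blast
  have mem: "xs ! i \<in> ?S" if "i < length xs" for i using xs(1) nth_mem[OF that] by blast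
  have ne: "xs ! i \<noteq> xs ! j" if "i < j" "j < length xs" for i j
    using xs(2)[OF that] by auto
  have "distinct xs"
    unfolding distinct_conv_nth using ne by (metis linorder_neqE_nat)
  then have "bij_betw ((!) xs) {..<length xs} ?S" using xs(1) by (intro bij_betw_nth) auto
  moreover have "(xs ! i, xs ! j) \<in> ?r \<longleftrightarrow> i \<le> j" if ij: "i < length xs" "j < length xs" for i j
  proof (cases i j rule: linorder_cases)
    case less
    have "\<not> key (xs ! j) < key (xs ! i)" using xs(2)[OF less ij(2)] by simp
    then have "(xs ! j, xs ! i) \<notin> ?r" using key mem ij ne[OF less ij(2)] by metis
    then show ?thesis using tot[OF mem[OF ij(1)] mem[OF ij(2)] ne[OF less ij(2)]] less by simp
  next
    case equal
    then show ?thesis using refl mem[OF ij(1)] by (auto dest: refl_onD)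
  next
    case greater
    have "\<not> key (xs ! i) < key (xs ! j)" using xs(2)[OF greater ij(1)] by simp
    then have "(xs ! i, xs ! j) \<notin> ?r" using key mem ij ne[OF greater ij(1)] by metis
    then show ?thesis using greater by simp
  qed
  ultimately show thesis by (rule that)
qed

lemma verts_induced [simp]: "verts (induced C S) = S"
  and distance_induced: "distance (induced C S) = restrict (distance C) (S \<times> S)"
  and order_rel_induced: "order_rel (induced C S) = order_rel C \<inter> S \<times> S"
  by (simp_all add: induced_def)

lemma induced_induced: "S \<subseteq> T \<Longrightarrow> induced (induced C T) S = induced C S"
  by (auto simp: induced_def fun_eq_iff restrict_def)

lemma order_embedding_inj:
  assumes "\<And>i j. i < a \<Longrightarrow> j < a \<Longrightarrow> (e i, e j) \<in> r \<longleftrightarrow> i \<le> (j :: nat)"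
  shows "inj_on e {..<a}"
  by (rule inj_onI) (use assms in \<open>metis lessThan_iff order_antisym nle_le\<close>)

lemma induced_image_copy:
  assumes g: "bij_betw g {..<a} (verts A)"
      "\<And>i j. i < a \<Longrightarrow> j < a \<Longrightarrow> (g i, g j) \<in> order_rel A \<longleftrightarrow> i \<le> (j :: nat)"
    and e: "\<And>i. i < a \<Longrightarrow> e i \<in> verts C"
      "\<And>i j. i < a \<Longrightarrow> j < a \<Longrightarrow> (e i, e j) \<in> order_rel C \<longleftrightarrow> i \<le> j"
      "\<And>i j. i < a \<Longrightarrow> j < a \<Longrightarrow> distance C (e i, e j) = distance A (g i, g j)"
  shows "induced C (e ` {..<a}) \<in> copies C A"
proof -
  define f where "f = e \<circ> inv_into {..<a} g"
  have fg: "f (g i) = e i" if "i < a" for i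
    using g(1) that by (simp add: f_def bij_betw_inv_into_left)
  have verts: "verts A = g ` {..<a}" using g(1) by (simp add: bij_betw_def)
  have "bij_betw e {..<a} (e ` {..<a})"
    using order_embedding_inj[OF e(2)] by (simp add: bij_betw_def)
  then have "bij_betw f (verts A) (e ` {..<a})"
    unfolding f_def using bij_betw_inv_into[OF g(1)] by (rule bij_betw_trans[rotated])
  then have "isomorphism f A (induced C (e ` {..<a}))"
    unfolding isomorphism_def verts distance_induced order_rel_induced
    using fg e g(2) by simp
  then show ?thesis
    unfolding copies_def substructures_def isomorphic_def using e(1) by blast
qed

text \<open>
  Every copy of \<open>A\<close> inside the image of an embedding \<open>e\<close> of a space on \<open>{..<b}\<close> comes from an
  embedding \<open>h\<close> of \<open>A\<close> into that space.
\<close>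

lemma copy_in_induced_image:
  assumes g: "bij_betw g {..<a} (verts A)"
      "\<And>i j. i < a \<Longrightarrow> j < a \<Longrightarrow> (g i, g j) \<in> order_rel A \<longleftrightarrow> i \<le> (j :: nat)"
    and e: "\<And>i j. i < b \<Longrightarrow> j < b \<Longrightarrow> (e i, e j) \<in> order_rel C \<longleftrightarrow> i \<le> (j :: nat)"
    and A': "A' \<in> copies (induced C (e ` {..<b})) A"
  obtains h where "\<And>i. i < a \<Longrightarrow> h i < b"
    "\<And>i j. i < a \<Longrightarrow> j < a \<Longrightarrow> h i \<le> h j \<longleftrightarrow> i \<le> j"
    "\<And>i j. i < a \<Longrightarrow> j < a \<Longrightarrow> distance C (e (h i), e (h j)) = distance A (g i, g j)"
    "A' = induced C ((\<lambda>i. e (h i)) ` {..<a})"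
proof -
  from A' obtain S f where S: "S \<subseteq> e ` {..<b}" "A' = induced (induced C (e ` {..<b})) S"
    and f: "isomorphism f A A'"
    by (auto simp: copies_def substructures_def isomorphic_def)
  have A'_eq: "A' = induced C S" using S induced_induced by metis
  have verts: "verts A = g ` {..<a}" using g(1) by (simp add: bij_betw_def)
  have S_eq: "S = f ` g ` {..<a}"
    using f unfolding isomorphism_def A'_eq verts bij_betw_def by simp
  define h where "h i = inv_into {..<b} e (f (g i))" for i
  have mem: "f (g i) \<in> e ` {..<b}" if "i < a" for i using S(1) S_eq that by blast
  have eh: "e (h i) = f (g i)" if "i < a" for i
    unfolding h_def using mem[OF that] by (rule f_inv_into_f)
  have h: "h i < b" if "i < a" for i
    using inv_into_into[OF mem[OF that]] by (simp add: h_def)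
  have fS: "f (g i) \<in> S" if "i < a" for i using that S_eq by blast
  show thesis
  proof
    show "h i < b" if "i < a" for i by (rule h[OF that])
    fix i j assume ij: "i < a" "j < a"
    have iso: "distance A' (f (g i), f (g j)) = distance A (g i, g j)"
      "(f (g i), f (g j)) \<in> order_rel A' \<longleftrightarrow> (g i, g j) \<in> order_rel A"
      using f ij unfolding isomorphism_def verts by auto
    show "distance C (e (h i), e (h j)) = distance A (g i, g j)"
      using iso(1) fS ij by (simp add: A'_eq distance_induced eh)
    have "(e (h i), e (h j)) \<in> order_rel C \<longleftrightarrow> i \<le> j"
      using iso(2) fS ij g(2)[OF ij] by (simp add: A'_eq order_rel_induced eh)
    then show "h i \<le> h j \<longleftrightarrow> i \<le> j" using e[OF h h] ij by simp
  next
    have "(\<lambda>i. e (h i)) ` {..<a} = S"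
      unfolding S_eq image_image by (rule image_cong) (auto simp: eh)
    then show "A' = induced C ((\<lambda>i. e (h i)) ` {..<a})" by (simp add: A'_eq)
  qed
qed

lemma ex_inj_on_infinite:
  assumes "infinite (UNIV :: 'v set)" "finite X"
  obtains \<iota> :: "'a \<Rightarrow> 'v" where "inj_on \<iota> X"
proof -
  obtain T :: "'v set" where "finite T" "card T = card X"
    using infinite_arbitrarily_large[OF assms(1)] by blast
  then obtain \<iota> where "bij_betw \<iota> X T"
    using finite_same_card_bij[OF assms(2)] by metis
  then show thesis using that by (auto simp: bij_betw_def)
qed

context truncated_monoid
begin

lemma vmetric_of_space:
  assumes A: "A \<in> ordered_metric_spaces" and g: "bij_betw g {..<a} (verts A)"
    and V: "\<And>i j. i < a \<Longrightarrow> j < a \<Longrightarrow> distance A (g i, g j) \<in> V"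
  shows "vmetric a (\<lambda>i j. distance A (g i, g j))"
proof -
  have m: "monoid_metric (verts A) (distance A)"
    using A by (simp add: ordered_metric_spaces_def)
  have mem: "g i \<in> verts A" if "i < a" for i using g that by (auto simp: bij_betw_def)
  have inj: "g i = g j \<longleftrightarrow> i = j" if "i < a" "j < a" for i j
    using g that by (auto simp: bij_betw_def dest: inj_onD)
  show ?thesis unfolding vmetric_def
  proof (intro allI impI conjI)
    fix i j assume ij: "i < a" "j < a"
    show "distance A (g i, g j) \<in> V" by (rule V[OF ij])
    show "distance A (g i, g j) = 0 \<longleftrightarrow> i = j"
      using m mem ij inj[OF ij] unfolding monoid_metric_def by blast
    show "distance A (g i, g j) = distance A (g j, g i)"
      using m mem ij unfolding monoid_metric_def by blast
    show "distance A (g i, g k) \<le> distance A (g i, g j) + distance A (g j, g k)" if "k < a" for k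
      using m mem ij that unfolding monoid_metric_def by blast
  qed
qed

lemma point_embedding:
  assumes d: "vmetric a d" and xs: "set xs = lip a d"
    "\<And>p q. p < length xs \<Longrightarrow> q < length xs \<Longrightarrow> prec (xs ! p) (xs ! q) \<longleftrightarrow> p < q"
    and u: "rigid 0 (length xs) u" "length u = n"
    and inj: "inj_on \<iota> (words n)" and ij: "i < a" "j < a"
  shows "\<iota> (point xs u i) \<in> verts (word_space n \<iota>)"
    "(\<iota> (point xs u i), \<iota> (point xs u j)) \<in> order_rel (word_space n \<iota>) \<longleftrightarrow> i \<le> j"
    "distance (word_space n \<iota>) (\<iota> (point xs u i), \<iota> (point xs u j)) = d i j"
proof -
  have w: "point xs u k \<in> words n" if "k < a" for k
    using point_words[OF xs(1) u(1) that] u(2) by simp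
  show "\<iota> (point xs u i) \<in> verts (word_space n \<iota>)" using w[OF ij(1)] by (simp add: word_space_def)
  have less: "point xs u k < point xs u l" if "k < l" "l < a" for k l
    by (rule point_less[OF d xs u(1) that])
  have "point xs u i \<le> point xs u j \<longleftrightarrow> i \<le> j"
    using less[of i j] less[of j i] ij by (cases i j rule: linorder_cases) auto
  then show "(\<iota> (point xs u i), \<iota> (point xs u j)) \<in> order_rel (word_space n \<iota>) \<longleftrightarrow> i \<le> j"
    using word_space_order[OF inj w[OF ij(1)] w[OF ij(2)]] by simp
  show "distance (word_space n \<iota>) (\<iota> (point xs u i), \<iota> (point xs u j)) = d i j"
    using word_space_distance[OF inj w[OF ij(1)] w[OF ij(2)]] point_dist[OF d xs(1) u(1) ij] by simp
qed

end

theorem theorem5p3: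
  assumes vertex_supply: "infinite (UNIV :: 'v set)"
    and archimedean: "\<And>r s :: 'm::distance_monoid.
      r \<noteq> 0 \<Longrightarrow> s \<noteq> 0 \<Longrightarrow> \<exists>n>0. s \<le> nmult n r"
  shows "ramsey_class (ordered_metric_spaces :: ('v, 'm) ordered_space set)"
  unfolding ramsey_class_def
proof (intro ballI allI impI)
  fix A B :: "('v, 'm) ordered_space" and k :: nat
  assume A: "A \<in> ordered_metric_spaces" and B: "B \<in> ordered_metric_spaces" and k: "0 < k"
  obtain gA :: "nat \<Rightarrow> 'v" and a where gA: "bij_betw gA {..<a} (verts A)"
    "\<And>i j. i < a \<Longrightarrow> j < a \<Longrightarrow> (gA i, gA j) \<in> order_rel A \<longleftrightarrow> i \<le> j"
    using ex_indexing[OF A] by blast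
  obtain gB :: "nat \<Rightarrow> 'v" and b where gB: "bij_betw gB {..<b} (verts B)"
    "\<And>i j. i < b \<Longrightarrow> j < b \<Longrightarrow> (gB i, gB j) \<in> order_rel B \<longleftrightarrow> i \<le> j"
    using ex_indexing[OF B] by blast
  define dA where "dA i j = distance A (gA i, gA j)" for i j
  define dB where "dB i j = distance B (gB i, gB j)" for i j
  define D where "D = (\<lambda>(i, j). dA i j) ` ({..<a} \<times> {..<a}) \<union> (\<lambda>(i, j). dB i j) ` ({..<b} \<times> {..<b})"
  have "finite D" by (simp add: D_def)
  then obtain V top where trunc: "truncated_monoid V top" and D: "D \<subseteq> V"
    using ex_truncated_monoid[OF _ archimedean] by blast
  interpret truncated_monoid V top by (rule trunc)
  have "dA i j \<in> V" if "i < a" "j < a" for i j using D that by (auto simp: D_def)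
  then have dA: "vmetric a dA" using vmetric_of_space[OF A gA(1)] by (simp add: dA_def[abs_def])
  have "dB i j \<in> V" if "i < b" "j < b" for i j using D that by (auto simp: D_def)
  then have dB: "vmetric b dB" using vmetric_of_space[OF B gB(1)] by (simp add: dB_def[abs_def])
  obtain xs where xs: "set xs = lip a dA"
    "\<And>p q. p < length xs \<Longrightarrow> q < length xs \<Longrightarrow> prec (xs ! p) (xs ! q) \<longleftrightarrow> p < q"
    using ex_lip_enumeration by blast
  obtain ys where ys: "set ys = lip b dB"
    "\<And>p q. p < length ys \<Longrightarrow> q < length ys \<Longrightarrow> prec (ys ! p) (ys ! q) \<longleftrightarrow> p < q"
    using ex_lip_enumeration by blast
  have "0 < length xs" "0 < length ys"
    using xs(1) ys(1) zero_lip by (metis empty_iff empty_set length_greater_0_conv)+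
  from dual_ramsey[OF this, of k] obtain n where
    n: "\<And>\<chi>. (\<forall>w. \<chi> w < k) \<Longrightarrow> \<exists>u. length u = n \<and> rigid 0 (length ys) u \<and>
      (\<forall>w w'. length w = length ys \<longrightarrow> length w' = length ys \<longrightarrow>
        rigid 0 (length xs) w \<longrightarrow> rigid 0 (length xs) w' \<longrightarrow>
        \<chi> (map ((!) w) u) = (\<chi> (map ((!) w') u) :: nat))" by blast
  obtain \<iota> :: "'m list \<Rightarrow> 'v" where inj: "inj_on \<iota> (words n)"
    using ex_inj_on_infinite[OF vertex_supply finite_words] by blast
  define C where "C = word_space n \<iota>"
  have xs_embed: "\<iota> (point xs v i) \<in> verts C"
    "(\<iota> (point xs v i), \<iota> (point xs v j)) \<in> order_rel C \<longleftrightarrow> i \<le> j"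
    "distance C (\<iota> (point xs v i), \<iota> (point xs v j)) = dA i j"
    if "rigid 0 (length xs) v" "length v = n" "i < a" "j < a" for v i j
    unfolding C_def using point_embedding[OF dA xs that(1,2) inj that(3,4)] by blast+
  have ys_embed: "\<iota> (point ys v i) \<in> verts C"
    "(\<iota> (point ys v i), \<iota> (point ys v j)) \<in> order_rel C \<longleftrightarrow> i \<le> j"
    "distance C (\<iota> (point ys v i), \<iota> (point ys v j)) = dB i j"
    if "rigid 0 (length ys) v" "length v = n" "i < b" "j < b" for v i j
    unfolding C_def using point_embedding[OF dB ys that(1,2) inj that(3,4)] by blast+
  define copy where "copy v = induced C ((\<lambda>i. \<iota> (point xs v i)) ` {..<a})" for v
  have copy: "copy v \<in> copies C A" if v: "rigid 0 (length xs) v" "length v = n" for v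
    unfolding copy_def
    by (rule induced_image_copy[OF gA]) (use xs_embed[OF v] in \<open>simp_all add: dA_def\<close>)
  show "\<exists>C\<in>ordered_metric_spaces. \<forall>P :: nat \<Rightarrow> ('v, 'm) ordered_space set.
      disjoint_family_on P {..<k} \<and> (\<Union>i<k. P i) = copies C A \<longrightarrow>
      (\<exists>B'\<in>copies C B. \<exists>i<k. copies B' A \<subseteq> P i)"
  proof (rule bexI[of _ C], intro allI impI)
    show "C \<in> ordered_metric_spaces" unfolding C_def by (rule word_space_in_class[OF inj])
    fix P :: "nat \<Rightarrow> ('v, 'm) ordered_space set"
    assume "disjoint_family_on P {..<k} \<and> (\<Union>i<k. P i) = copies C A"
    then have P: "(\<Union>i<k. P i) = copies C A" by blast
    (* A rigid word is coloured by a class containing the copy of A that it determines; words that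
       determine no copy get the dummy colour 0. *)
    define \<chi> where "\<chi> v = (if \<exists>i<k. copy v \<in> P i then SOME i. i < k \<and> copy v \<in> P i else 0)" for v
    have colour: "\<chi> v < k \<and> copy v \<in> P (\<chi> v)" if "\<exists>i<k. copy v \<in> P i" for v
      using someI_ex[OF that] that by (simp add: \<chi>_def)
    then have bounded: "\<forall>v. \<chi> v < k" using k by (auto simp: \<chi>_def)
    from n[OF this] obtain u where u: "length u = n" "rigid 0 (length ys) u"
      and mono: "\<And>w w'. length w = length ys \<Longrightarrow> length w' = length ys \<Longrightarrow>
        rigid 0 (length xs) w \<Longrightarrow> rigid 0 (length xs) w' \<Longrightarrow>
        \<chi> (map ((!) w) u) = \<chi> (map ((!) w') u)" by blast
    define e where "e i = \<iota> (point ys u i)" for i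
    note e = ys_embed[OF u(2,1), folded e_def]
    define B' where "B' = induced C (e ` {..<b})"
    have B': "B' \<in> copies C B"
      unfolding B'_def by (rule induced_image_copy[OF gB]) (use e in \<open>simp_all add: dB_def\<close>)
    (* A copy of A in B' is given by an embedding h of A in B, and w is the restriction along h. *)
    have factor: "\<exists>w. length w = length ys \<and> rigid 0 (length xs) w \<and> A' = copy (map ((!) w) u)"
      if A': "A' \<in> copies B' A" for A'
    proof -
      obtain h :: "nat \<Rightarrow> nat" where h: "\<And>i. i < a \<Longrightarrow> h i < b"
        "\<And>i j. i < a \<Longrightarrow> j < a \<Longrightarrow> h i \<le> h j \<longleftrightarrow> i \<le> j"
        "\<And>i j. i < a \<Longrightarrow> j < a \<Longrightarrow> distance C (e (h i), e (h j)) = distance A (gA i, gA j)"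
        "A' = induced C ((\<lambda>i. e (h i)) ` {..<a})"
        using copy_in_induced_image[OF gA e(2) A'[unfolded B'_def]] by blast
      have "dB (h i) (h j) = dA i j" if "i < a" "j < a" for i j
        using h(3)[OF that] e(3)[OF h(1)[OF that(1)] h(1)[OF that(2)]] by (simp add: dA_def)
      then interpret metric_embedding V top a b dA dB h
        using dB h by unfold_locales auto
      obtain w where w: "length w = length ys" "rigid 0 (length xs) w"
        "\<And>p. p < length ys \<Longrightarrow> xs ! (w ! p) = restriction (ys ! p)"
        using restriction_rigid[OF xs ys] by blast
      have "e (h i) = \<iota> (point xs (map ((!) w) u) i)" if "i < a" for i
      proof -
        have "q < length ys" if "q \<in> set u" for q using rigid_set[OF u(2)] that by blast
        then show ?thesis using w(3) that by (simp add: e_def point_def cong: map_cong)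
      qed
      then have "A' = copy (map ((!) w) u)"
        unfolding h(4) copy_def by (intro arg_cong[where f = "induced C"] image_cong) auto
      then show ?thesis using w(1,2) by blast
    qed
    have in_class: "copy (map ((!) w) u) \<in> P (\<chi> (map ((!) w) u))"
      if "length w = length ys" "rigid 0 (length xs) w" for w
    proof -
      have "copy (map ((!) w) u) \<in> copies C A"
        by (rule copy) (use rigid_compose[OF u(2) that(2,1)] u(1) in simp_all)
      then show ?thesis using colour P by blast
    qed
    have "\<exists>i<k. copies B' A \<subseteq> P i"
    proof (cases "copies B' A = {}")
      case True
      then show ?thesis using k by auto
    next
      case False
      then obtain w0 where w0: "length w0 = length ys" "rigid 0 (length xs) w0" using factor by blast
      have "A' \<in> P (\<chi> (map ((!) w0) u))" if "A' \<in> copies B' A" for A'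
        using factor[OF that] in_class mono[OF _ w0(1) _ w0(2)] by metis
      then show ?thesis using bounded by blast
    qed
    then show "\<exists>B'\<in>copies C B. \<exists>i<k. copies B' A \<subseteq> P i" using B' by blast
  qed
qed

end
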